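(* There is an algorithm that, given the data of a finite Markov decision process with $m$ states and $q$ state-action pairs, computes within $O(m^2q)$ arithmetic operations (with a constant independent of the process) the number $\tilde\Delta_L\in(0,1]$ and the sets $A_L(x)$, $x\in\mathbb{X}$, which define the set of deterministic policies $\mathbb{F}_L=\{\phi\in\mathbb{F}:\phi(x)\in A_L(x)\ \forall x\in\mathbb{X}\}$. Moreover, every $\phi\in\mathbb{F}_L$ is optimal for the infinite-horizon problem for every discount factor $\alpha\in[0,\tilde\Delta_L]$ with $\alpha<1$.
   Context: A finite Markov decision process (MDP) has a finite state set $\mathbb{X}=\{x^1,\ldots,x^m\}$, a finite nonempty action set $A(x)$ for each $x\in\mathbb{X}$, real one-step rewards $r(x,a)$, and transition probabilities $p(\cdot|x,a)$ on $\mathbb{X}$; $q=\sum_x|A(x)|$. $\mathbb{F}$ is the set of deterministic policies, i.e. maps $\phi$ on $\mathbb{X}$ with $\phi(x)\in A(x)$. $P(\phi)$ is the stochastic matrix with entries $p(x^j|x^i,\phi(x^i))$ and $r(\phi)(x)=r(x,\phi(x))$. For $\alpha\in[0,1)$, $v_\alpha^\phi=\sum_{t=0}^\infty\alpha^tP(\phi)^tr(\phi)$; $\phi$ is optimal for the infinite-horizon problem with discount factor $\alpha$ if $v_\alpha^\phi(x)=\max_{\psi\in\mathbb{F}}v_\alpha^\psi(x)$ for all $x\in\mathbb{X}$. Arithmetic operations (including comparisons) are on real numbers, each at unit cost. Let $R_1^*=\frac12\{\max_{x,a}r(x,a)-\min_{x,a}r(x,a)\}$ (over $x\in\mathbb{X},a\in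 A(x)$). Let $A_{-1}(x)=A(x)$, $r_0(x)=\max_{a\in A(x)}r(x,a)$, $A_0(x)=\operatorname{argmax}_{a\in A(x)}r(x,a)$ and, for $n\ge1$, $r_n(x)=\max_{a\in A_{n-1}(x)}\sum_yp(y|x,a)r_{n-1}(y)$, $A_n(x)=\operatorname{argmax}_{a\in A_{n-1}(x)}\sum_yp(y|x,a)r_{n-1}(y)$. Let $\mathbb{F}_n=\{\phi\in\mathbb{F}:\phi(x)\in A_n(x)\ \forall x\}$, $\mathbb{X}_n=\{x\in\mathbb{X}:A_n(x)\ne A_{n-1}(x)\}$ for $n\ge0$, and $L=\min\{K\in\{0,1,2,\ldots\}:\mathbb{F}_n=\mathbb{F}_{n+1}\text{ for all }n\ge K\}$. Let $C_{-1}=\infty$ and, for $n\ge0$, $C_n=C_{n-1}$ if $\mathbb{X}_n=\emptyset$, and otherwise $C_n=\min\{C_{n-1},\min_{x\in\mathbb{X}_n}(r_n(x)-\max_{a\in A_{n-1}(x)\setminus A_n(x)}g_n(x,a))\}$, where $g_0(x,a)=r(x,a)$ and $g_n(x,a)=\sum_yp(y|x,a)r_{n-1}(y)$ for $n\ge1$. Finally $\tilde\Delta_n=\frac{C_n}{2R_1^*+C_n}$ if $C_n<\infty$ and $\tilde\Delta_n=1$ if $C_n=\infty$. *)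

theory Defs
  imports Complex_Main "HOL-Library.FuncSet" "HOL-Library.Extended_Real"
    "HOL-Library.More_List" "Jordan_Normal_Form.Matrix"
begin

section \<open>Finite Markov decision processes\<close>

text \<open>The states \<open>x\<^sup>1, \<dots>, x\<^sup>m\<close> are represented by their indices \<open>0, \<dots>, m - 1\<close>, so that the number
  of states can be quantified over; \<open>acts M i\<close> is an arbitrary finite set of actions, and
  \<open>tprob M i a j\<close> is \<open>p(j | i, a)\<close>.\<close>

record 'a mdp =
  nstates :: nat
  acts :: "nat \<Rightarrow> 'a set"
  rew :: "nat \<Rightarrow> 'a \<Rightarrow> real"
  tprob :: "nat \<Rightarrow> 'a \<Rightarrow> nat \<Rightarrow> real"

definition finite_mdp :: "'a mdp \<Rightarrow> bool" where
  "finite_mdp M \<longleftrightarrow> 0 < nstates M \<and>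
     (\<forall>i<nstates M. finite (acts M i) \<and> acts M i \<noteq> {} \<and>
        (\<forall>a\<in>acts M i. (\<forall>j<nstates M. 0 \<le> tprob M i a j) \<and> (\<Sum>j<nstates M. tprob M i a j) = 1))"

definition num_pairs :: "'a mdp \<Rightarrow> nat" where
  "num_pairs M = (\<Sum>i<nstates M. card (acts M i))"

definition policies :: "'a mdp \<Rightarrow> (nat \<Rightarrow> 'a) set" where
  "policies M = (\<Pi>\<^sub>E i\<in>{..<nstates M}. acts M i)"

definition P_mat :: "'a mdp \<Rightarrow> (nat \<Rightarrow> 'a) \<Rightarrow> real mat" where
  "P_mat M \<phi> = mat (nstates M) (nstates M) (\<lambda>(i, j). tprob M i (\<phi> i) j)"

definition r_vec :: "'a mdp \<Rightarrow> (nat \<Rightarrow> 'a) \<Rightarrow> real vec" where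
  "r_vec M \<phi> = vec (nstates M) (\<lambda>i. rew M i (\<phi> i))"

definition disc_value :: "'a mdp \<Rightarrow> real \<Rightarrow> (nat \<Rightarrow> 'a) \<Rightarrow> nat \<Rightarrow> real" where
  "disc_value M \<alpha> \<phi> i = (\<Sum>t. \<alpha> ^ t * ((P_mat M \<phi> ^\<^sub>m t) *\<^sub>v r_vec M \<phi>) $ i)"

definition optimal_policy :: "'a mdp \<Rightarrow> real \<Rightarrow> (nat \<Rightarrow> 'a) \<Rightarrow> bool" where
  "optimal_policy M \<alpha> \<phi> \<longleftrightarrow>
     \<phi> \<in> policies M \<and> (\<forall>i<nstates M. disc_value M \<alpha> \<phi> i = (MAX \<psi>\<in>policies M. disc_value M \<alpha> \<psi> i))"


section \<open>The sets \<open>A\<^sub>n\<close> and the numbers \<open>\<Delta>\<^sub>n\<close>\<close>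

definition R1 :: "'a mdp \<Rightarrow> real" where
  "R1 M = 1 / 2 * (Max {rew M i a | i a. i < nstates M \<and> a \<in> acts M i}
                 - Min {rew M i a | i a. i < nstates M \<and> a \<in> acts M i})"

text \<open>To keep indices in \<open>nat\<close>, \<open>A_prev M n\<close> stands for \<open>A\<^bsub>n-1\<^esub>\<close>; in particular \<open>A_prev M 0 = A\<^bsub>-1\<^esub>\<close>.\<close>

fun g_val :: "'a mdp \<Rightarrow> nat \<Rightarrow> nat \<Rightarrow> 'a \<Rightarrow> real"
  and r_val :: "'a mdp \<Rightarrow> nat \<Rightarrow> nat \<Rightarrow> real"
  and A_prev :: "'a mdp \<Rightarrow> nat \<Rightarrow> nat \<Rightarrow> 'a set"
  and A_set :: "'a mdp \<Rightarrow> nat \<Rightarrow> nat \<Rightarrow> 'a set"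
where
  "g_val M 0 i a = rew M i a"
| "g_val M (Suc n) i a = (\<Sum>j<nstates M. tprob M i a j * r_val M n j)"
| "r_val M n i = (MAX a\<in>A_prev M n i. g_val M n i a)"
| "A_prev M 0 i = acts M i"
| "A_prev M (Suc n) i = A_set M n i"
| "A_set M n i = {a. is_arg_max (\<lambda>b. g_val M n i b) (\<lambda>b. b \<in> A_prev M n i) a}"

definition F_set :: "'a mdp \<Rightarrow> nat \<Rightarrow> (nat \<Rightarrow> 'a) set" where
  "F_set M n = {\<phi> \<in> policies M. \<forall>i<nstates M. \<phi> i \<in> A_set M n i}"

definition X_set :: "'a mdp \<Rightarrow> nat \<Rightarrow> nat set" where
  "X_set M n = {i. i < nstates M \<and> A_set M n i \<noteq> A_prev M n i}"

definition L_idx :: "'a mdp \<Rightarrow> nat" where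
  "L_idx M = (LEAST K. \<forall>n\<ge>K. F_set M n = F_set M (Suc n))"

definition C_step :: "'a mdp \<Rightarrow> nat \<Rightarrow> ereal \<Rightarrow> ereal" where
  "C_step M n c =
     (if X_set M n = {} then c
      else min c (ereal (MIN i\<in>X_set M n.
             r_val M n i - (MAX a\<in>A_prev M n i - A_set M n i. g_val M n i a))))"

fun C_val :: "'a mdp \<Rightarrow> nat \<Rightarrow> ereal" where
  "C_val M 0 = C_step M 0 \<infinity>"
| "C_val M (Suc n) = C_step M (Suc n) (C_val M n)"

definition Delta_val :: "'a mdp \<Rightarrow> nat \<Rightarrow> real" where
  "Delta_val M n =
     (if C_val M n < \<infinity>
      then real_of_ereal (C_val M n) / (2 * R1 M + real_of_ereal (C_val M n))
      else 1)"


section \<open>Algorithms over the real numbers\<close>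

text \<open>A real random access machine, presented as a while language.  A program refers to finitely many
  named arrays, holding either real numbers or natural numbers; a scalar is cell 0 of an
  array.  Natural numbers only serve for counting and addressing.  Real cells hold exact real
  numbers and support field operations and comparisons; there is no conversion between the two
  sorts, no rounding, and program constants are integers, so a program cannot hide information in
  a real constant.  Division by 0 yields 0, which a program could equally obtain by a test.\<close>

record ram_state =
  nats :: "string \<Rightarrow> nat \<Rightarrow> nat"
  reals :: "string \<Rightarrow> nat \<Rightarrow> real"

datatype nexp =
    NConst nat
  | NCell string nexp
  | NAdd nexp nexp
  | NSub nexp nexp

datatype rexp =
    RConst int
  | RCell string nexp
  | RAdd rexp rexp
  | RSub rexp rexp
  | RMul rexp rexp
  | RDiv rexp rexp

datatype bexp =
    NLess nexp nexp
  | RLess rexp rexp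
  | BNot bexp
  | BAnd bexp bexp

datatype com =
    Skip
  | NAssign string nexp nexp
  | RAssign string nexp rexp
  | Seq com com
  | Cond bexp com com
  | While bexp com

primrec nval :: "nexp \<Rightarrow> ram_state \<Rightarrow> nat" where
  "nval (NConst k) s = k"
| "nval (NCell v e) s = nats s v (nval e s)"
| "nval (NAdd e f) s = nval e s + nval f s"
| "nval (NSub e f) s = nval e s - nval f s"

primrec rval :: "rexp \<Rightarrow> ram_state \<Rightarrow> real" where
  "rval (RConst k) s = of_int k"
| "rval (RCell v e) s = reals s v (nval e s)"
| "rval (RAdd e f) s = rval e s + rval f s"
| "rval (RSub e f) s = rval e s - rval f s"
| "rval (RMul e f) s = rval e s * rval f s"
| "rval (RDiv e f) s = rval e s / rval f s"

primrec bval :: "bexp \<Rightarrow> ram_state \<Rightarrow> bool" where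
  "bval (NLess e f) s \<longleftrightarrow> nval e s < nval f s"
| "bval (RLess e f) s \<longleftrightarrow> rval e s < rval f s"
| "bval (BNot b) s \<longleftrightarrow> \<not> bval b s"
| "bval (BAnd b c) s \<longleftrightarrow> bval b s \<and> bval c s"

text \<open>Every operation on real numbers (arithmetic operation or comparison) costs one unit.  One
  unit is also charged for every other primitive step (memory access, counting and addressing,
  assignment, branching), so the running time bounds the number of arithmetic operations.\<close>

primrec ncost :: "nexp \<Rightarrow> nat" where
  "ncost (NConst k) = 1"
| "ncost (NCell v e) = 1 + ncost e"
| "ncost (NAdd e f) = 1 + ncost e + ncost f"
| "ncost (NSub e f) = 1 + ncost e + ncost f"

primrec rcost :: "rexp \<Rightarrow> nat" where
  "rcost (RConst k) = 1"
| "rcost (RCell v e) = 1 + ncost e"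
| "rcost (RAdd e f) = 1 + rcost e + rcost f"
| "rcost (RSub e f) = 1 + rcost e + rcost f"
| "rcost (RMul e f) = 1 + rcost e + rcost f"
| "rcost (RDiv e f) = 1 + rcost e + rcost f"

primrec bcost :: "bexp \<Rightarrow> nat" where
  "bcost (NLess e f) = 1 + ncost e + ncost f"
| "bcost (RLess e f) = 1 + rcost e + rcost f"
| "bcost (BNot b) = 1 + bcost b"
| "bcost (BAnd b c) = 1 + bcost b + bcost c"

text \<open>\<open>exec c s t s'\<close>: started in \<open>s\<close>, the program \<open>c\<close> halts in \<open>s'\<close> after \<open>t\<close> steps.\<close>

inductive exec :: "com \<Rightarrow> ram_state \<Rightarrow> nat \<Rightarrow> ram_state \<Rightarrow> bool" where
  Skip: "exec Skip s 1 s"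
| NAssign: "exec (NAssign v i e) s (1 + ncost i + ncost e)
     (s\<lparr>nats := (nats s)(v := (nats s v)(nval i s := nval e s))\<rparr>)"
| RAssign: "exec (RAssign v i e) s (1 + ncost i + rcost e)
     (s\<lparr>reals := (reals s)(v := (reals s v)(nval i s := rval e s))\<rparr>)"
| Seq: "\<lbrakk>exec c s t s'; exec d s' u s''\<rbrakk> \<Longrightarrow> exec (Seq c d) s (t + u) s''"
| Cond_True: "\<lbrakk>bval b s; exec c s t s'\<rbrakk> \<Longrightarrow> exec (Cond b c d) s (1 + bcost b + t) s'"
| Cond_False: "\<lbrakk>\<not> bval b s; exec d s t s'\<rbrakk> \<Longrightarrow> exec (Cond b c d) s (1 + bcost b + t) s'"
| While_False: "\<not> bval b s \<Longrightarrow> exec (While b c) s (1 + bcost b) s"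
| While_True: "\<lbrakk>bval b s; exec c s t s'; exec (While b c) s' u s''\<rbrakk> \<Longrightarrow>
     exec (While b c) s (1 + bcost b + t + u) s''"


section \<open>Input and output\<close>

text \<open>The machine does not see action names: the data are presented along an arbitrary enumeration
  \<open>as i\<close> of each action set.  The state-action pairs, listed state by state, are numbered
  \<open>0, \<dots>, q - 1\<close>; cell \<open>k\<close> of \<open>r\<close> holds the reward of pair \<open>k\<close> and cell \<open>k * m + j\<close> of \<open>p\<close> its
  probability of moving to state \<open>j\<close>.  All cells not holding data are 0.\<close>

definition enumerates_acts :: "'a mdp \<Rightarrow> (nat \<Rightarrow> 'a list) \<Rightarrow> bool" where
  "enumerates_acts M as \<longleftrightarrow> (\<forall>i<nstates M. distinct (as i) \<and> set (as i) = acts M i)"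

definition pair_list :: "'a mdp \<Rightarrow> (nat \<Rightarrow> 'a list) \<Rightarrow> (nat \<times> 'a) list" where
  "pair_list M as = concat (map (\<lambda>i. map (Pair i) (as i)) [0..<nstates M])"

definition mdp_input :: "'a mdp \<Rightarrow> (nat \<Rightarrow> 'a list) \<Rightarrow> ram_state" where
  "mdp_input M as =
     \<lparr>nats = (\<lambda>_ _. 0)
        (''m'' := nth_default 0 [nstates M],
         ''nacts'' := nth_default 0 (map (\<lambda>i. length (as i)) [0..<nstates M])),
      reals = (\<lambda>_ _. 0)
        (''r'' := nth_default 0 (map (\<lambda>(i, a). rew M i a) (pair_list M as)),
         ''p'' := nth_default 0
           (concat (map (\<lambda>(i, a). map (tprob M i a) [0..<nstates M]) (pair_list M as))))\<rparr>"

text \<open>The sets \<open>B i\<close> are returned as a 0/1 vector over the numbered state-action pairs.\<close>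

definition outputs :: "'a mdp \<Rightarrow> (nat \<Rightarrow> 'a list) \<Rightarrow> real \<Rightarrow> (nat \<Rightarrow> 'a set) \<Rightarrow> ram_state \<Rightarrow> bool" where
  "outputs M as d B s \<longleftrightarrow>
     reals s ''Delta'' 0 = d \<and>
     (\<forall>k<length (pair_list M as). case pair_list M as ! k of (i, a) \<Rightarrow>
        nats s ''A'' k = (if a \<in> B i then 1 else 0))"

end

theory Submission
  imports Defs "Jordan_Normal_Form.Determinant"
begin

text \<open>Since \<open>r\<^sub>0, \<dots>, r\<^sub>m\<close> are \<open>m + 1\<close> vectors in an \<open>m\<close>-dimensional space, one of them is a
  combination of its predecessors, and this forces \<open>A\<^sub>n = A\<^sub>m\<close> for \<open>n \<ge> m\<close>.  So \<open>m + 1\<close> rounds, each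
  computing \<open>r\<^sub>n\<close>, \<open>A\<^sub>n\<close> and \<open>C\<^sub>n\<close> in \<open>O(mq)\<close> operations, suffice, and \<open>L\<close> need not be known.  Every
  policy in \<open>F\<^sub>L\<close> has the value function \<open>v = \<Sum>\<^sub>t \<alpha>\<^sup>t r\<^sub>t\<close>; for \<open>\<alpha> \<le> \<Delta>\<^sub>L\<close> this function satisfies
  \<open>r(x, a) + \<alpha> \<Sum>\<^sub>y p(y | x, a) v(y) \<le> v(x)\<close> for all pairs, hence dominates the value of every policy.\<close>

text \<open>The difference between v(x) and r(x, a) + alpha sum_y p(y | x, a) v(y) is the series of
  the terms alpha^t (r_t(x) - g_t(x, a)). The obstacle is that g_t(x, a) also enters after a has
  left the sets A_n, and r_t(x), a maximum over surviving actions only, may then be smaller, so the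
  terms have no common sign. They vanish until a is dropped, and the term at which it is dropped
  must pay for all later ones. The number Delta_L is the break-even point: for 0 <= alpha < 1, C_L
  >= 2 R_1 alpha / (1 - alpha) means alpha <= C_L / (2 R_1 + C_L).\<close>

lemma ex_linear_relation:
  fixes v :: "nat \<Rightarrow> nat \<Rightarrow> real"
  obtains k c where "k \<le> m" "\<And>i. i < m \<Longrightarrow> v k i = (\<Sum>j<k. c j * v j i)"
proof -
  \<comment> \<open>The zero row turns m equations in m + 1 unknowns into a square singular system,
    so the determinant supplies a nonzero kernel vector.\<close>
  define A where "A = mat\<^sub>r (Suc m) (Suc m)
    (\<lambda>i. if i = m then 0\<^sub>v (Suc m) else vec (Suc m) (\<lambda>j. v j i))"
  have A: "A \<in> carrier_mat (Suc m) (Suc m)"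
    by (simp add: A_def)
  have "det A = 0"
    unfolding A_def by (rule det_row_0) auto
  then obtain w where w: "w \<in> carrier_vec (Suc m)" "w \<noteq> 0\<^sub>v (Suc m)" "A *\<^sub>v w = 0\<^sub>v (Suc m)"
    using det_0_iff_vec_prod_zero[OF A] by blast
  have rel: "(\<Sum>j\<le>m. w $ j * v j i) = 0" if "i < m" for i
  proof -
    have "(A *\<^sub>v w) $ i = row A i \<bullet> w"
      using that A by simp
    also have "row A i = vec (Suc m) (\<lambda>j. v j i)"
      using that by (intro eq_vecI) (simp_all add: A_def)
    also have "\<dots> \<bullet> w = (\<Sum>j\<le>m. w $ j * v j i)"
      using w(1) by (auto simp: scalar_prod_def mult.commute atLeast0LessThan lessThan_Suc_atMost intro!: sum.cong)
    finally show ?thesis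
      using w(3) that by simp
  qed
  \<comment> \<open>The vector with the largest index of nonzero weight can be expressed by strictly
    earlier ones.\<close>
  define k where "k = (GREATEST j. j \<le> m \<and> w $ j \<noteq> 0)"
  have "\<exists>j\<le>m. w $ j \<noteq> 0"
    using w(1,2) by (auto simp: vec_eq_iff less_Suc_eq_le)
  then obtain j0 where "j0 \<le> m \<and> w $ j0 \<noteq> 0"
    by blast
  from GreatestI_nat[of "\<lambda>j. j \<le> m \<and> w $ j \<noteq> 0", OF this, of m]
  have k: "k \<le> m" "w $ k \<noteq> 0"
    by (auto simp: k_def)
  have above: "w $ j = 0" if "k < j" "j \<le> m" for j
    using Greatest_le_nat[of "\<lambda>j. j \<le> m \<and> w $ j \<noteq> 0" j m] that by (auto simp: k_def)
  have "v k i = (\<Sum>j<k. - (w $ j / w $ k) * v j i)" if "i < m" for i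
  proof -
    have "0 = (\<Sum>j\<le>k. w $ j * v j i)"
      unfolding rel[OF that, symmetric] using k above by (intro sum.mono_neutral_right) auto
    also have "\<dots> = (\<Sum>j<k. w $ j * v j i) + w $ k * v k i"
      by (simp add: lessThan_Suc_atMost[symmetric])
    finally have "v k i = - (\<Sum>j<k. w $ j * v j i) / w $ k"
      using k(2) by (simp add: field_simps)
    then show ?thesis
      by (simp add: sum_negf sum_divide_distrib)
  qed
  with k(1) show ?thesis
    by (rule that)
qed


section \<open>The sequences of sets and values\<close>

declare g_val.simps(2) [simp del] r_val.simps [simp del] A_set.simps [simp del]

locale fin_mdp =
  fixes M :: "'a mdp"
  assumes fin: "finite_mdp M"
begin

abbreviation m :: nat where "m \<equiv> nstates M"

definition rews :: "real set" where
  "rews = {rew M i a | i a. i < m \<and> a \<in> acts M i}"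

abbreviation lo :: real where "lo \<equiv> Min rews"
abbreviation hi :: real where "hi \<equiv> Max rews"

lemma nstates_pos: "0 < m"
  and finite_acts: "i < m \<Longrightarrow> finite (acts M i)"
  and acts_nonempty: "i < m \<Longrightarrow> acts M i \<noteq> {}"
  and tprob_nonneg: "\<lbrakk>i < m; a \<in> acts M i; j < m\<rbrakk> \<Longrightarrow> 0 \<le> tprob M i a j"
  and tprob_sum: "\<lbrakk>i < m; a \<in> acts M i\<rbrakk> \<Longrightarrow> (\<Sum>j<m. tprob M i a j) = 1"
  using fin by (auto simp: finite_mdp_def)

lemma finite_rews: "finite rews"
proof -
  have "rews = (\<Union>i\<in>{..<m}. rew M i ` acts M i)"
    by (auto simp: rews_def)
  then show ?thesis
    by (simp add: finite_acts)
qed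

lemma rew_mem: "\<lbrakk>i < m; a \<in> acts M i\<rbrakk> \<Longrightarrow> rew M i a \<in> rews"
  by (auto simp: rews_def)

lemma rews_nonempty: "rews \<noteq> {}"
  using nstates_pos acts_nonempty[OF nstates_pos] rew_mem by blast

lemma R1_eq: "2 * R1 M = hi - lo"
  by (simp add: R1_def rews_def)

lemma R1_nonneg: "0 \<le> R1 M"
  using R1_eq Min_le[OF finite_rews Max_in[OF finite_rews rews_nonempty]] by simp

lemma A_set_subset_prev: "A_set M n i \<subseteq> A_prev M n i"
  by (auto simp: A_set.simps is_arg_max_def)

lemma A_prev_finite: "i < m \<Longrightarrow> finite (A_prev M n i)"
  by (induction n) (auto simp: finite_acts intro: finite_subset[OF A_set_subset_prev])

lemma argmax_set:
  assumes "finite S" "S \<noteq> {}"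
  shows "{a. is_arg_max (f :: _ \<Rightarrow> real) (\<lambda>b. b \<in> S) a} = {a \<in> S. f a = Max (f ` S)}"
    and "{a. is_arg_max f (\<lambda>b. b \<in> S) a} \<noteq> {}"
proof -
  show *: "{a. is_arg_max f (\<lambda>b. b \<in> S) a} = {a \<in> S. f a = Max (f ` S)}"
    using assms by (auto simp: is_arg_max_linorder intro: Max_eqI[symmetric])
  show "{a. is_arg_max f (\<lambda>b. b \<in> S) a} \<noteq> {}"
  proof -
    have "Max (f ` S) \<in> f ` S"
      using assms by simp
    then show ?thesis
      unfolding * by auto
  qed
qed

lemma A_prev_nonempty: "i < m \<Longrightarrow> A_prev M n i \<noteq> {}"
proof (induction n)
  case (Suc n)
  then show ?case
    using argmax_set(2)[OF A_prev_finite[OF Suc.prems, of n]]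
    by (simp add: A_set.simps)
qed (simp add: acts_nonempty)

lemma A_set_nonempty: "i < m \<Longrightarrow> A_set M n i \<noteq> {}"
  using A_prev_nonempty[of i "Suc n"] by simp

lemma A_set_eq: "i < m \<Longrightarrow> A_set M n i = {a \<in> A_prev M n i. g_val M n i a = r_val M n i}"
  using argmax_set(1)[OF A_prev_finite A_prev_nonempty]
  by (simp add: A_set.simps r_val.simps)

lemma A_prev_antimono: "k \<le> n \<Longrightarrow> A_prev M n i \<subseteq> A_prev M k i"
  by (rule lift_Suc_antimono_le[of "\<lambda>n. A_prev M n i"]) (use A_set_subset_prev in auto)

lemma A_set_antimono: "k \<le> n \<Longrightarrow> A_set M n i \<subseteq> A_set M k i"
  using A_prev_antimono[of "Suc k" "Suc n" i] by simp

lemma A_prev_subset: "A_prev M n i \<subseteq> acts M i"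
  using A_prev_antimono[of 0 n i] by simp

lemma A_set_subset: "A_set M n i \<subseteq> acts M i"
  using A_set_subset_prev A_prev_subset by blast

lemma g_le_r: "\<lbrakk>i < m; a \<in> A_prev M n i\<rbrakk> \<Longrightarrow> g_val M n i a \<le> r_val M n i"
  by (auto simp: r_val.simps A_prev_finite)

lemma g_less_r: "\<lbrakk>i < m; a \<in> A_prev M n i - A_set M n i\<rbrakk> \<Longrightarrow> g_val M n i a < r_val M n i"
  using g_le_r[of i a n] by (auto simp: A_set_eq)

lemma ex_r_eq_g: "i < m \<Longrightarrow> \<exists>a\<in>A_set M n i. r_val M n i = g_val M n i a"
  using A_set_nonempty[of i n] by (auto simp: A_set_eq)

section \<open>Range of the values g_n and r_n\<close>

lemma average_bounds:
  assumes "i < m" "a \<in> acts M i" "\<And>j. j < m \<Longrightarrow> f j \<in> {x..y}"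
  shows "(\<Sum>j<m. tprob M i a j * f j) \<in> {x..y}"
proof -
  have "(\<Sum>j<m. tprob M i a j * x) \<le> (\<Sum>j<m. tprob M i a j * f j)"
    "(\<Sum>j<m. tprob M i a j * f j) \<le> (\<Sum>j<m. tprob M i a j * y)"
    using assms by (auto intro!: sum_mono mult_left_mono tprob_nonneg)
  then show ?thesis
    by (simp add: sum_distrib_right[symmetric] tprob_sum[OF assms(1,2)])
qed

text \<open>Averaging never leaves the range of the rewards. All actions are covered, dropped ones
  too: the optimality proof compares r_n with g_n(a) after a has been dropped.\<close>

lemma g_bounds: "\<lbrakk>i < m; a \<in> acts M i\<rbrakk> \<Longrightarrow> g_val M n i a \<in> {lo..hi}"
proof (induction n arbitrary: i a)
  case 0
  then show ?case
    using rew_mem finite_rews by simp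
next
  case (Suc n)
  have "r_val M n j \<in> {lo..hi}" if "j < m" for j
    using ex_r_eq_g[OF that, of n] A_set_subset Suc.IH[OF that] by force
  then show ?case
    unfolding g_val.simps by (intro average_bounds Suc.prems)
qed

lemma r_bounds: "i < m \<Longrightarrow> r_val M n i \<in> {lo..hi}"
  using ex_r_eq_g[of i n] g_bounds A_set_subset by force


section \<open>Stabilization after at most \<open>m\<close> steps\<close>

text \<open>A linear relation among \<open>r\<^sub>0, \<dots>, r\<^sub>k\<close> propagates to \<open>r\<^sub>n, \<dots>, r\<^bsub>n+k\<^esub>\<close>, because every action
  in \<open>A\<^bsub>n+k\<^esub>\<close> maps \<open>r\<^sub>j\<close> to \<open>r\<^bsub>j+1\<^esub>\<close> for \<open>j < n + k\<close>; hence all these actions attain the maximum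
  again.\<close>

lemma A_set_Suc_eq:
  assumes "m \<le> n" "i < m"
  shows "A_set M (Suc n) i = A_set M n i"
proof -
  obtain k c where k: "k \<le> m" and c: "\<And>i. i < m \<Longrightarrow> r_val M k i = (\<Sum>j<k. c j * r_val M j i)"
    by (rule ex_linear_relation[of m "r_val M"]) blast
  \<comment> \<open>The point of this formula is that its right-hand side does not mention a: all
    actions of \<open>A_set M (k + n) i\<close> are equally good at the next level.\<close>
  have g: "g_val M (Suc (k + n)) i a = (\<Sum>j<k. c j * r_val M (Suc (n + j)) i)"
    if rel: "\<And>i. i < m \<Longrightarrow> r_val M (k + n) i = (\<Sum>j<k. c j * r_val M (n + j) i)"
      and i: "i < m" and a: "a \<in> A_set M (k + n) i" for n i a
  proof -
    have "g_val M (Suc (k + n)) i a = (\<Sum>y<m. \<Sum>j<k. c j * (tprob M i a y * r_val M (n + j) y))"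
      unfolding g_val.simps by (simp add: rel sum_distrib_left mult.left_commute)
    also have "\<dots> = (\<Sum>j<k. c j * g_val M (Suc (n + j)) i a)"
      by (subst sum.swap) (simp add: g_val.simps sum_distrib_left)
    also have "\<dots> = (\<Sum>j<k. c j * r_val M (Suc (n + j)) i)"
    proof (rule sum.cong)
      fix j assume "j \<in> {..<k}"
      then have "a \<in> A_set M (Suc (n + j)) i"
        using A_set_antimono[of "Suc (n + j)" "k + n" i] a by auto
      then show "c j * g_val M (Suc (n + j)) i a = c j * r_val M (Suc (n + j)) i"
        using i by (simp add: A_set_eq)
    qed simp
    finally show ?thesis .
  qed
  have rel: "\<forall>i<m. r_val M (k + n) i = (\<Sum>j<k. c j * r_val M (n + j) i)" for n
  proof (induction n)
    case 0
    then show ?case by (simp add: c)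
  next
    case (Suc n)
    show ?case
    proof (intro allI impI)
      fix i assume i: "i < m"
      \<comment> \<open>A maximizer of the next level still lies in
        \<open>A_set M (k + n) i\<close>, so \<open>g\<close> evaluates the maximum itself.\<close>
      obtain a where a: "a \<in> A_set M (Suc (k + n)) i" "r_val M (Suc (k + n)) i = g_val M (Suc (k + n)) i a"
        using ex_r_eq_g[OF i] by blast
      then show "r_val M (k + Suc n) i = (\<Sum>j<k. c j * r_val M (Suc n + j) i)"
        using g[of n i a] Suc i A_set_subset_prev[of "Suc (k + n)" i] by auto
    qed
  qed
  obtain n' where n': "n = k + n'"
    using k assms(1) le_Suc_ex le_trans by blast
  obtain b where b: "b \<in> A_set M (Suc n) i" "r_val M (Suc n) i = g_val M (Suc n) i b"
    using ex_r_eq_g[OF assms(2)] by blast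
  \<comment> \<open>The maximizer b also belongs to \<open>A_set M n i\<close>, where
    \<open>g\<close> gives all actions the same value.\<close>
  have "g_val M (Suc n) i a = r_val M (Suc n) i" if "a \<in> A_set M n i" for a
    using g[of n' i] rel[of n'] that b A_set_subset_prev[of "Suc n" i] assms(2) by (auto simp: n')
  then show ?thesis
    using assms(2) by (auto simp: A_set_eq[of i "Suc n"])
qed

text \<open>\<open>L_idx\<close> compares sets of policies, whereas stabilization is a fact about
  sets of actions. A nonempty product determines its factors.\<close>

lemma F_set_eq_iff: "F_set M n = F_set M k \<longleftrightarrow> (\<forall>i<m. A_set M n i = A_set M k i)"
proof
  have F: "F_set M n = (\<Pi>\<^sub>E i\<in>{..<m}. A_set M n i)" for n
    using subsetD[OF A_set_subset[of n]] by (auto simp: F_set_def policies_def PiE_iff extensional_def)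
  have ne: "F_set M n \<noteq> {}" for n
    unfolding F using A_set_nonempty by (auto simp: PiE_eq_empty_iff)
  show "\<forall>i<m. A_set M n i = A_set M k i" if "F_set M n = F_set M k"
    using that ne unfolding F by (subst (asm) PiE_eq_iff_not_empty) (auto simp: A_set_nonempty)
qed (auto simp: F_set_def)

lemma L_idx_le: "L_idx M \<le> m"
    and A_set_L_idx: "\<lbrakk>L_idx M \<le> n; i < m\<rbrakk> \<Longrightarrow> A_set M n i = A_set M (L_idx M) i"
proof -
  let ?P = "\<lambda>K. \<forall>n\<ge>K. F_set M n = F_set M (Suc n)"
  have m: "?P m"
    using A_set_Suc_eq by (simp add: F_set_eq_iff)
  then show "L_idx M \<le> m"
    unfolding L_idx_def by (rule Least_le)
  have L: "?P (L_idx M)"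
    unfolding L_idx_def by (rule LeastI[of ?P, OF m])
  show "A_set M n i = A_set M (L_idx M) i" if "L_idx M \<le> n" "i < m"
    using that(1)
  proof (induction rule: dec_induct)
    case (step n)
    then show ?case
      using L that(2) unfolding F_set_eq_iff by metis
  qed simp
qed


section \<open>The numbers \<open>C\<^sub>n\<close> as minimal gaps\<close>

text \<open>Flattening the nested minimum and maximum of \<open>C_step\<close> into one set of
  losses turns C_n into a single minimum. The optimality proof needs the bound for one particular
  loss, and the program meets the losses one at a time.\<close>

definition gaps_at :: "nat \<Rightarrow> real set" where
  "gaps_at n = {r_val M n i - g_val M n i a | i a. i < m \<and> a \<in> A_prev M n i - A_set M n i}"

definition gaps :: "nat \<Rightarrow> real set" where
  "gaps n = (\<Union>k\<le>n. gaps_at k)"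

lemma gaps_at_eq: "gaps_at n = (\<Union>i\<in>X_set M n. (\<lambda>a. r_val M n i - g_val M n i a) ` (A_prev M n i - A_set M n i))"
  using A_set_subset_prev by (auto simp: gaps_at_def X_set_def)

lemma finite_gaps_at: "finite (gaps_at n)"
  unfolding gaps_at_eq by (auto simp: X_set_def A_prev_finite)

lemma gaps_Suc: "gaps (Suc n) = gaps n \<union> gaps_at (Suc n)"
  by (auto simp: gaps_def atMost_Suc)

lemma finite_gaps: "finite (gaps n)"
  by (simp add: gaps_def finite_gaps_at)

lemma gaps_pos: "x \<in> gaps n \<Longrightarrow> 0 < x"
  by (auto simp: gaps_def gaps_at_def intro: g_less_r)

lemma X_set_empty_iff: "X_set M n = {} \<longleftrightarrow> gaps_at n = {}"
  using A_set_subset_prev[of n] by (fastforce simp: gaps_at_def X_set_def)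

text \<open>At each state the smallest loss belongs to the best dropped action. Restriction to
  \<open>X_set\<close> keeps the inner maximum away from the empty set.\<close>

lemma Min_gaps_at:
  assumes "X_set M n \<noteq> {}"
  shows "(MIN i\<in>X_set M n. r_val M n i - (MAX a\<in>A_prev M n i - A_set M n i. g_val M n i a))
    = Min (gaps_at n)"
    (is "Min (?f ` _) = _")
proof (rule antisym)
  have fin: "finite (A_prev M n i - A_set M n i)" and ne: "A_prev M n i - A_set M n i \<noteq> {}"
    and i: "i < m" if "i \<in> X_set M n" for i
    using that A_prev_finite by (auto simp: X_set_def dest: subsetD[OF A_set_subset_prev])
  have finX: "finite (X_set M n)"
    by (simp add: X_set_def)
  have "gaps_at n \<noteq> {}"
    using assms X_set_empty_iff by blast
  then have "Min (gaps_at n) \<in> gaps_at n"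
    by (simp add: finite_gaps_at)
  then obtain i a where ia: "i \<in> X_set M n" "a \<in> A_prev M n i - A_set M n i"
    "Min (gaps_at n) = r_val M n i - g_val M n i a"
    unfolding gaps_at_eq by blast
  have "Min (?f ` X_set M n) \<le> ?f i"
    using finX ia(1) by simp
  also have "\<dots> \<le> Min (gaps_at n)"
    using fin[OF ia(1)] ia(2,3) by simp
  finally show "Min (?f ` X_set M n) \<le> Min (gaps_at n)" .
  obtain i where i: "i \<in> X_set M n" "Min (?f ` X_set M n) = ?f i"
  proof -
    have "Min (?f ` X_set M n) \<in> ?f ` X_set M n"
      using finX assms by (intro Min_in) simp_all
    then show ?thesis
      using that by blast
  qed
  obtain a where "a \<in> A_prev M n i - A_set M n i"
    "(MAX a\<in>A_prev M n i - A_set M n i. g_val M n i a) = g_val M n i a"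
  proof -
    have "(MAX a\<in>A_prev M n i - A_set M n i. g_val M n i a) \<in> g_val M n i ` (A_prev M n i - A_set M n i)"
      using fin[OF i(1)] ne[OF i(1)] by (intro Max_in) simp_all
    then show ?thesis
      using that by blast
  qed
  then have "?f i \<in> gaps_at n"
    using i(1) unfolding gaps_at_eq by auto
  then show "Min (gaps_at n) \<le> Min (?f ` X_set M n)"
    unfolding i(2) by (simp add: finite_gaps_at)
qed

lemma C_step_eq:
  "C_step M n c = (if gaps_at n = {} then c else min c (ereal (Min (gaps_at n))))"
  using Min_gaps_at[of n] by (simp add: C_step_def X_set_empty_iff)

lemma C_val_eq: "C_val M n = (if gaps n = {} then \<infinity> else ereal (Min (gaps n)))"
proof (induction n)
  case 0
  then show ?case
    by (simp add: C_step_eq gaps_def)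
next
  case (Suc n)
  then show ?case
    by (auto simp: C_step_eq gaps_Suc Min_Un finite_gaps finite_gaps_at)
qed

text \<open>A loss of step n + 1 needs an action in \<open>A_set M n\<close> outside
  \<open>A_set M (Suc n)\<close>, and these sets agree from L on. So C_n is frozen together with
  A_n.\<close>

lemma gaps_L_idx: "L_idx M \<le> n \<Longrightarrow> gaps n = gaps (L_idx M)"
proof (induction rule: dec_induct)
  case (step n)
  have "gaps_at (Suc n) = {}"
    using A_set_L_idx[of n] A_set_L_idx[of "Suc n"] step.hyps by (auto simp: gaps_at_def)
  then show ?case
    using step.IH by (simp add: gaps_Suc)
qed simp

lemma Delta_val_eq:
  "Delta_val M n = (if gaps n = {} then 1 else Min (gaps n) / (hi - lo + Min (gaps n)))"
  by (simp add: Delta_val_def C_val_eq R1_eq)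

lemma Delta_val_bounds: "Delta_val M n \<in> {0<..1}"
proof (cases "gaps n = {}")
  case False
  then have "0 < Min (gaps n)"
    using gaps_pos finite_gaps by simp
  then show ?thesis
    using False R1_nonneg by (simp add: Delta_val_eq R1_eq[symmetric])
qed (simp add: Delta_val_eq)

end


section \<open>Optimality\<close>

context fin_mdp
begin

section \<open>Powers of transition matrices and discounted series\<close>

lemma P_mat_carrier [simp]: "P_mat M \<phi> \<in> carrier_mat m m"
  by (simp add: P_mat_def)

lemma dim_P_mat [simp]: "dim_row (P_mat M \<phi>) = m" "dim_col (P_mat M \<phi>) = m"
  by (simp_all add: P_mat_def)

lemma r_vec_carrier [simp]: "r_vec M \<phi> \<in> carrier_vec m"
  by (simp add: r_vec_def)

lemma P_mat_mult_vec:
  assumes "w \<in> carrier_vec m" "i < m"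
  shows "(P_mat M \<phi> *\<^sub>v w) $ i = (\<Sum>j<m. tprob M i (\<phi> i) j * w $ j)"
  using assms by (simp add: P_mat_def scalar_prod_def atLeast0LessThan)

lemma pow_P_mat_carrier [simp]: "P_mat M \<phi> ^\<^sub>m t \<in> carrier_mat m m"
  by (simp add: pow_carrier_mat)

lemma pow_P_mat_mult_carrier [simp]: "w \<in> carrier_vec m \<Longrightarrow> P_mat M \<phi> ^\<^sub>m t *\<^sub>v w \<in> carrier_vec m"
  by (rule mult_mat_vec_carrier[OF pow_P_mat_carrier])

lemma P_mat_mult_carrier [simp]: "w \<in> carrier_vec m \<Longrightarrow> P_mat M \<phi> *\<^sub>v w \<in> carrier_vec m"
  by (rule mult_mat_vec_carrier[OF P_mat_carrier])

text \<open>The additional factor acts on the vector, so inductions over t must leave the vector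
  arbitrary.\<close>

lemma pow_P_mat_Suc:
  "w \<in> carrier_vec m \<Longrightarrow> P_mat M \<phi> ^\<^sub>m Suc t *\<^sub>v w = P_mat M \<phi> ^\<^sub>m t *\<^sub>v (P_mat M \<phi> *\<^sub>v w)"
  by (simp add: assoc_mult_mat_vec[OF pow_P_mat_carrier P_mat_carrier])

lemma policies_acts: "\<lbrakk>\<phi> \<in> policies M; i < m\<rbrakk> \<Longrightarrow> \<phi> i \<in> acts M i"
  by (auto simp: policies_def)

lemma pow_P_mat_mono:
  assumes "\<phi> \<in> policies M" "i < m"
    and "u \<in> carrier_vec m" "w \<in> carrier_vec m" "\<And>i. i < m \<Longrightarrow> u $ i \<le> w $ i"
  shows "(P_mat M \<phi> ^\<^sub>m t *\<^sub>v u) $ i \<le> (P_mat M \<phi> ^\<^sub>m t *\<^sub>v w) $ i"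
  using assms(3-)
proof (induction t arbitrary: u w)
  case 0
  have "P_mat M \<phi> ^\<^sub>m 0 = 1\<^sub>m m"
    by (simp add: P_mat_def)
  then show ?case
    using 0 assms(2) by (simp del: pow_mat.simps)
next
  case (Suc t)
  have "(P_mat M \<phi> *\<^sub>v u) $ i \<le> (P_mat M \<phi> *\<^sub>v w) $ i" if "i < m" for i
    using that Suc.prems assms(1) tprob_nonneg policies_acts
    by (auto simp: P_mat_mult_vec simp del: index_mult_mat_vec intro!: sum_mono mult_left_mono)
  then show ?case
    unfolding pow_P_mat_Suc[OF Suc.prems(1)] pow_P_mat_Suc[OF Suc.prems(2)]
    by (intro Suc.IH) (simp_all add: Suc.prems)
qed

lemma pow_P_mat_const:
  assumes "\<phi> \<in> policies M" "i < m"
  shows "(P_mat M \<phi> ^\<^sub>m t *\<^sub>v vec m (\<lambda>_. c)) $ i = c"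
proof (induction t)
  case 0
  have "P_mat M \<phi> ^\<^sub>m 0 = 1\<^sub>m m"
    by (simp add: P_mat_def)
  then show ?case
    using assms(2) by (simp del: pow_mat.simps)
next
  case (Suc t)
  have "P_mat M \<phi> *\<^sub>v vec m (\<lambda>_. c) = vec m (\<lambda>_. c)"
    using assms(1)
    by (intro eq_vecI)
      (simp_all add: P_mat_mult_vec sum_distrib_right[symmetric] tprob_sum policies_acts
        del: index_mult_mat_vec)
  then show ?case
    using Suc by (simp add: pow_P_mat_Suc del: pow_mat.simps)
qed

text \<open>Monotonicity squeezes the image between those of the constant vectors -B and B, which a
  stochastic matrix fixes. A bound uniform in t makes the discounted series converge.\<close>

lemma pow_P_mat_abs_le:
  assumes "\<phi> \<in> policies M" "i < m" "w \<in> carrier_vec m" "\<And>i. i < m \<Longrightarrow> \<bar>w $ i\<bar> \<le> B"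
  shows "\<bar>(P_mat M \<phi> ^\<^sub>m t *\<^sub>v w) $ i\<bar> \<le> B"
proof -
  have "(P_mat M \<phi> ^\<^sub>m t *\<^sub>v w) $ i \<le> (P_mat M \<phi> ^\<^sub>m t *\<^sub>v vec m (\<lambda>_. B)) $ i"
    using assms by (intro pow_P_mat_mono) (auto simp: abs_le_iff)
  moreover have "(P_mat M \<phi> ^\<^sub>m t *\<^sub>v vec m (\<lambda>_. - B)) $ i \<le> (P_mat M \<phi> ^\<^sub>m t *\<^sub>v w) $ i"
    using assms by (intro pow_P_mat_mono) (auto simp: abs_le_iff minus_le_iff)
  ultimately show ?thesis
    unfolding pow_P_mat_const[OF assms(1,2)] by simp
qed

lemma vec_bounded:
  fixes w :: "real vec"
  obtains B where "\<And>i. i < m \<Longrightarrow> \<bar>w $ i\<bar> \<le> B"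
proof
  show "\<bar>w $ i\<bar> \<le> (\<Sum>i<m. \<bar>w $ i\<bar>)" if "i < m" for i
    using that by (intro member_le_sum) auto
qed

lemma summable_discounted:
  fixes \<alpha> :: real
  assumes "0 \<le> \<alpha>" "\<alpha> < 1" "\<And>t. \<bar>x t\<bar> \<le> B"
  shows "summable (\<lambda>t. \<alpha> ^ t * x t)"
proof (rule summable_comparison_test')
  show "summable (\<lambda>t. \<alpha> ^ t * B)"
    using assms(1,2) by (intro summable_mult2 summable_geometric) simp
  show "norm (\<alpha> ^ t * x t) \<le> \<alpha> ^ t * B" for t
    using assms by (simp add: abs_mult mult_left_mono)
qed

text \<open>The hypothesis gives r(psi) <= v - alpha P(psi) v. Applying alpha^t P(psi)^t preserves
  this and makes the right-hand side telescope, with remainder tending to 0.\<close>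

lemma disc_value_le_superharmonic:
  assumes \<alpha>: "0 \<le> \<alpha>" "\<alpha> < 1" and \<psi>: "\<psi> \<in> policies M" and i: "i < m"
    and super: "\<And>i a. \<lbrakk>i < m; a \<in> acts M i\<rbrakk> \<Longrightarrow>
      rew M i a + \<alpha> * (\<Sum>j<m. tprob M i a j * v j) \<le> v i"
  shows "disc_value M \<alpha> \<psi> i \<le> v i"
proof -
  let ?P = "P_mat M \<psi>" and ?v = "vec m v"
  define u where "u t = \<alpha> ^ t * (?P ^\<^sub>m t *\<^sub>v ?v) $ i" for t
  have "?P ^\<^sub>m 0 = 1\<^sub>m m"
    by (simp add: P_mat_def)
  then have u0: "u 0 = v i"
    using i by (simp add: u_def del: pow_mat.simps)
  have step: "\<alpha> ^ t * (?P ^\<^sub>m t *\<^sub>v r_vec M \<psi>) $ i \<le> u t - u (Suc t)" for t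
  proof -
    have Pv: "?P *\<^sub>v ?v \<in> carrier_vec m"
      by simp
    have "(?P ^\<^sub>m t *\<^sub>v r_vec M \<psi>) $ i \<le> (?P ^\<^sub>m t *\<^sub>v (?v - \<alpha> \<cdot>\<^sub>v (?P *\<^sub>v ?v))) $ i"
    proof (rule pow_P_mat_mono[OF \<psi> i])
      show "?v - \<alpha> \<cdot>\<^sub>v (?P *\<^sub>v ?v) \<in> carrier_vec m"
        using Pv by simp
      show "r_vec M \<psi> $ i \<le> (?v - \<alpha> \<cdot>\<^sub>v (?P *\<^sub>v ?v)) $ i" if "i < m" for i
        using that Pv super[OF that policies_acts[OF \<psi> that]]
        by (simp add: r_vec_def P_mat_mult_vec del: index_mult_mat_vec)
    qed simp
    also have "?P ^\<^sub>m t *\<^sub>v (?v - \<alpha> \<cdot>\<^sub>v (?P *\<^sub>v ?v))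
      = ?P ^\<^sub>m t *\<^sub>v ?v - \<alpha> \<cdot>\<^sub>v (?P ^\<^sub>m Suc t *\<^sub>v ?v)"
      unfolding pow_P_mat_Suc[OF vec_carrier]
      by (subst mult_minus_distrib_mat_vec[OF pow_P_mat_carrier])
        (use Pv in \<open>simp_all add: mult_mat_vec[OF pow_P_mat_carrier]\<close>)
    also have "\<dots> $ i = (?P ^\<^sub>m t *\<^sub>v ?v) $ i - \<alpha> * (?P ^\<^sub>m Suc t *\<^sub>v ?v) $ i"
      using i carrier_vecD[OF pow_P_mat_mult_carrier[OF vec_carrier]] by (simp del: pow_mat.simps)
    finally have "\<alpha> ^ t * (?P ^\<^sub>m t *\<^sub>v r_vec M \<psi>) $ i
      \<le> \<alpha> ^ t * ((?P ^\<^sub>m t *\<^sub>v ?v) $ i - \<alpha> * (?P ^\<^sub>m Suc t *\<^sub>v ?v) $ i)"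
      using \<alpha>(1) by (simp add: mult_left_mono del: pow_mat.simps)
    then show ?thesis
      by (simp add: u_def algebra_simps del: pow_mat.simps)
  qed
  obtain B where B: "\<And>i. i < m \<Longrightarrow> \<bar>?v $ i\<bar> \<le> B"
    by (rule vec_bounded[of ?v]) blast
  have "summable u"
    unfolding u_def using pow_P_mat_abs_le[OF \<psi> i vec_carrier B] \<alpha>
    by (intro summable_discounted) auto
  then have "u \<longlonglongrightarrow> 0"
    by (rule summable_LIMSEQ_zero)
  from telescope_sums'[OF this] have tele: "(\<lambda>t. u t - u (Suc t)) sums v i"
    by (simp add: u0)
  obtain B' where B': "\<And>i. i < m \<Longrightarrow> \<bar>r_vec M \<psi> $ i\<bar> \<le> B'"
    by (rule vec_bounded[of "r_vec M \<psi>"]) blast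
  have "summable (\<lambda>t. \<alpha> ^ t * (?P ^\<^sub>m t *\<^sub>v r_vec M \<psi>) $ i)"
    using pow_P_mat_abs_le[OF \<psi> i r_vec_carrier B'] \<alpha> by (intro summable_discounted) auto
  from suminf_le[OF step this sums_summable[OF tele]] show ?thesis
    by (simp add: disc_value_def sums_unique[OF tele, symmetric])
qed

section \<open>The value function of the policies in F_L\<close>

lemma F_set_L_idx_actions:
  assumes "\<phi> \<in> F_set M (L_idx M)" "i < m"
  shows "\<phi> i \<in> A_set M n i"
proof -
  \<comment> \<open>The level max n L treats both sides of L at once: up to L the sets decrease,
    from L on they are constant.\<close>
  have "A_set M (L_idx M) i \<subseteq> A_set M n i"
    using A_set_antimono[of n "max n (L_idx M)" i] A_set_L_idx[of "max n (L_idx M)" i] assms(2)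
    by simp
  then show ?thesis
    using assms by (auto simp: F_set_def)
qed

lemma pow_P_mat_r_vec:
  assumes "\<phi> \<in> F_set M (L_idx M)"
  shows "P_mat M \<phi> ^\<^sub>m t *\<^sub>v r_vec M \<phi> = vec m (r_val M t)"
proof -
  have g: "g_val M n i (\<phi> i) = r_val M n i" if "i < m" for n i
    using F_set_L_idx_actions[OF assms that] that by (auto simp: A_set_eq)
  have step: "P_mat M \<phi> *\<^sub>v vec m (r_val M n) = vec m (r_val M (Suc n))" for n
    using g[of _ "Suc n"]
    by (intro eq_vecI) (simp_all add: P_mat_mult_vec g_val.simps(2) del: index_mult_mat_vec)
  \<comment> \<open>The starting level n is arbitrary because each step of the induction replaces
    r_n by r_{n+1} inside the product.\<close>
  have "P_mat M \<phi> ^\<^sub>m t *\<^sub>v vec m (r_val M n) = vec m (r_val M (n + t))" for n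
  proof (induction t arbitrary: n)
    case 0
    have "P_mat M \<phi> ^\<^sub>m 0 = 1\<^sub>m m"
      by (simp add: P_mat_def)
    then show ?case
      by (simp del: pow_mat.simps)
  next
    case (Suc t)
    then show ?case
      unfolding pow_P_mat_Suc[OF vec_carrier] step by simp
  qed
  moreover have "r_vec M \<phi> = vec m (r_val M 0)"
    using g[of _ 0] by (intro eq_vecI) (simp_all add: r_vec_def)
  ultimately show ?thesis
    by simp
qed

text \<open>Choosing an action that leaves the sets \<open>A\<^sub>n\<close> at step \<open>n\<close> loses at least
  \<open>\<alpha>\<^sup>n C\<^sub>L\<close> at step \<open>n\<close>, and wins at most \<open>2 R\<^sub>1\<^sup>* (\<alpha>\<^bsup>n+1\<^esup> + \<alpha>\<^bsup>n+2\<^esup> + \<dots>)\<close> afterwards.\<close>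

lemma superharmonic_L_idx:
  assumes \<alpha>: "0 \<le> \<alpha>" "\<alpha> < 1" "\<alpha> \<le> Delta_val M (L_idx M)"
    and v: "\<And>i. i < m \<Longrightarrow> (\<lambda>t. \<alpha> ^ t * r_val M t i) sums v i"
    and i: "i < m" and a: "a \<in> acts M i"
  shows "rew M i a + \<alpha> * (\<Sum>j<m. tprob M i a j * v j) \<le> v i"
proof -
  \<comment> \<open>These are the terms of the gap in the claimed inequality: \<open>g_val\<close>
    at level 0 is the reward, and averaging the series of v shifts the level by one and absorbs the
    factor alpha.\<close>
  define D where "D t = \<alpha> ^ t * (r_val M t i - g_val M t i a)" for t
  have "(\<lambda>t. \<alpha> * (\<Sum>j<m. tprob M i a j * (\<alpha> ^ t * r_val M t j)))
      sums (\<alpha> * (\<Sum>j<m. tprob M i a j * v j))"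
    by (intro sums_mult sums_sum v) simp
  then have "(\<lambda>t. \<alpha> ^ Suc t * g_val M (Suc t) i a) sums (\<alpha> * (\<Sum>j<m. tprob M i a j * v j))"
    by (simp add: g_val.simps(2) sum_distrib_left mult_ac)
  from sums_Suc[OF this]
  have "(\<lambda>t. \<alpha> ^ t * g_val M t i a) sums (rew M i a + \<alpha> * (\<Sum>j<m. tprob M i a j * v j))"
    by (simp add: add.commute)
  from sums_diff[OF v[OF i] this]
  have D: "D sums (v i - (rew M i a + \<alpha> * (\<Sum>j<m. tprob M i a j * v j)))" (is "D sums ?d")
    by (simp add: D_def[abs_def] right_diff_distrib)
  have "0 \<le> ?d"
  proof (cases "\<forall>n. a \<in> A_set M n i")
    case True
    then have "D = (\<lambda>_. 0)"
      using i by (auto simp: D_def A_set_eq)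
    then show ?thesis
      using D sums_unique2[OF D, of 0] by simp
  next
    case False
    \<comment> \<open>All terms of D below the level at which a is dropped vanish.\<close>
    define n where "n = (LEAST n. a \<notin> A_set M n i)"
    have n: "a \<notin> A_set M n i"
      unfolding n_def using False LeastI_ex[of "\<lambda>n. a \<notin> A_set M n i"] by blast
    have before: "a \<in> A_set M t i" if "t < n" for t
      using not_less_Least[OF that[unfolded n_def]] by simp
    have prev: "a \<in> A_prev M n i"
      using before a by (cases n) auto
    let ?C = "Min (gaps (L_idx M))" and ?H = "hi - lo"
    have "r_val M n i - g_val M n i a \<in> gaps_at n"
      using i prev n by (auto simp: gaps_at_def)
    then have "r_val M n i - g_val M n i a \<in> gaps (max n (L_idx M))"
      by (auto simp: gaps_def)
    then have gap: "r_val M n i - g_val M n i a \<in> gaps (L_idx M)"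
      using gaps_L_idx[of "max n (L_idx M)"] by simp
    then have C: "?C \<le> r_val M n i - g_val M n i a"
      using finite_gaps by simp
    have ne: "gaps (L_idx M) \<noteq> {}"
      using gap by blast
    then have C_pos: "0 < ?C"
      using gaps_pos finite_gaps by simp
    have H: "0 \<le> ?H"
      using R1_nonneg R1_eq by simp
    have "\<alpha> \<le> ?C / (?H + ?C)"
      using \<alpha>(3) ne by (simp add: Delta_val_eq)
    then have key: "\<alpha> * (?H + ?C) \<le> ?C"
      using C_pos H by (simp add: pos_le_divide_eq)
    have D0: "(\<Sum>t<n. D t) = 0"
      using before i by (intro sum.neutral) (auto simp: D_def A_set_eq)
    have Dn: "(\<lambda>t. D (t + n)) sums ?d"
      using D by (simp add: sums_iff_shift D0)
    \<comment> \<open>A minorant of the shifted series: alpha^n C at t = 0 and -H alpha^(n+t)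
      afterwards. Adding H at t = 0 completes the tail to a geometric series.\<close>
    define E where "E t = \<alpha> ^ n * ((if t = 0 then ?C + ?H else 0) - ?H * \<alpha> ^ t)" for t
    have E: "E sums (\<alpha> ^ n * ((?C + ?H) - ?H * (1 / (1 - \<alpha>))))"
      unfolding E_def[abs_def] using \<alpha>
      by (intro sums_mult sums_diff geometric_sums) (auto intro: sums_single[of 0 "\<lambda>_. ?C + ?H"])
    have "E t \<le> D (t + n)" for t
    proof (cases t)
      case 0
      then show ?thesis
        using C \<alpha>(1) by (simp add: E_def D_def mult_left_mono)
    next
      case (Suc k)
      have "- ?H \<le> r_val M (t + n) i - g_val M (t + n) i a"
        using r_bounds[OF i, of "t + n"] g_bounds[OF i a, of "t + n"] by simp
      from mult_left_mono[OF this, of "\<alpha> ^ (t + n)"] show ?thesis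
        using \<alpha>(1) Suc by (simp add: E_def D_def power_add algebra_simps)
    qed
    from sums_le[OF this E Dn]
    have "\<alpha> ^ n * ((?C + ?H) - ?H * (1 / (1 - \<alpha>))) \<le> ?d" .
    \<comment> \<open>After multiplication by 1 - alpha this is \<open>key\<close>, the defining
      inequality of the threshold.\<close>
    moreover have "0 \<le> (?C + ?H) - ?H * (1 / (1 - \<alpha>))"
      using key \<alpha>(2) by (simp add: field_simps)
    then have "0 \<le> \<alpha> ^ n * ((?C + ?H) - ?H * (1 / (1 - \<alpha>)))"
      using \<alpha>(1) by simp
    ultimately show ?thesis
      by linarith
  qed
  then show ?thesis
    by simp
qed

lemma finite_policies: "finite (policies M)"
  by (auto simp: policies_def finite_acts intro: finite_PiE)

lemma optimal_policy_L_idx: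
  assumes "\<phi> \<in> F_set M (L_idx M)" "0 \<le> \<alpha>" "\<alpha> < 1" "\<alpha> \<le> Delta_val M (L_idx M)"
  shows "optimal_policy M \<alpha> \<phi>"
proof -
  have \<phi>: "\<phi> \<in> policies M"
    using assms(1) by (simp add: F_set_def)
  have v: "(\<lambda>t. \<alpha> ^ t * r_val M t i) sums disc_value M \<alpha> \<phi> i" if i: "i < m" for i
  proof -
    have "\<bar>r_val M t i\<bar> \<le> \<bar>lo\<bar> + \<bar>hi\<bar>" for t
      using r_bounds[OF i, of t] unfolding atLeastAtMost_iff by linarith
    then have "summable (\<lambda>t. \<alpha> ^ t * r_val M t i)"
      using assms(2,3) by (intro summable_discounted)
    then show ?thesis
      using i by (simp add: disc_value_def pow_P_mat_r_vec[OF assms(1)] summable_sums)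
  qed
  have "disc_value M \<alpha> \<psi> i \<le> disc_value M \<alpha> \<phi> i" if "\<psi> \<in> policies M" "i < m" for \<psi> i
    using superharmonic_L_idx[OF assms(2-4) v] assms(2,3) that
    by (intro disc_value_le_superharmonic) auto
  then show ?thesis
    unfolding optimal_policy_def using \<phi> finite_policies by (auto intro!: Max_eqI[symmetric])
qed

end


section \<open>Running times of programs\<close>

text \<open>A weakest precondition for termination whose postcondition receives the running time.
  Straight-line code is thus executed by rewriting, and \<open>hoare\<close> keeps only an upper
  bound.\<close>

definition runs :: "com \<Rightarrow> (nat \<Rightarrow> ram_state \<Rightarrow> bool) \<Rightarrow> ram_state \<Rightarrow> bool" where
  "runs c Q s \<longleftrightarrow> (\<exists>t s'. exec c s t s' \<and> Q t s')"

definition hoare :: "(ram_state \<Rightarrow> bool) \<Rightarrow> com \<Rightarrow> nat \<Rightarrow> (ram_state \<Rightarrow> bool) \<Rightarrow> bool" where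
  "hoare P c T Q \<longleftrightarrow> (\<forall>s. P s \<longrightarrow> runs c (\<lambda>t s'. t \<le> T \<and> Q s') s)"

abbreviation nset :: "string \<Rightarrow> nat \<Rightarrow> nat \<Rightarrow> ram_state \<Rightarrow> ram_state" where
  "nset x k v s \<equiv> s\<lparr>nats := (nats s)(x := (nats s x)(k := v))\<rparr>"

abbreviation rset :: "string \<Rightarrow> nat \<Rightarrow> real \<Rightarrow> ram_state \<Rightarrow> ram_state" where
  "rset x k v s \<equiv> s\<lparr>reals := (reals s)(x := (reals s x)(k := v))\<rparr>"

inductive_simps exec_simps:
  "exec Skip s t s'" "exec (NAssign x i e) s t s'" "exec (RAssign x i f) s t s'"
  "exec (Seq c d) s t s'" "exec (Cond b c d) s t s'"

lemma runs_simps: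
  "runs Skip Q s \<longleftrightarrow> Q 1 s"
  "runs (NAssign x i e) Q s \<longleftrightarrow> Q (1 + ncost i + ncost e) (nset x (nval i s) (nval e s) s)"
  "runs (RAssign x i f) Q s \<longleftrightarrow> Q (1 + ncost i + rcost f) (rset x (nval i s) (rval f s) s)"
  "runs (Seq c d) Q s \<longleftrightarrow> runs c (\<lambda>t. runs d (\<lambda>u. Q (t + u))) s"
  "runs (Cond b c d) Q s \<longleftrightarrow> runs (if bval b s then c else d) (\<lambda>t. Q (1 + bcost b + t)) s"
  by (auto simp: runs_def exec_simps) blast+

lemma runs_mono: "\<lbrakk>runs c Q s; \<And>t s'. Q t s' \<Longrightarrow> Q' t s'\<rbrakk> \<Longrightarrow> runs c Q' s"
  by (auto simp: runs_def)

lemma hoareI: "(\<And>s. P s \<Longrightarrow> runs c (\<lambda>t s'. t \<le> T \<and> Q s') s) \<Longrightarrow> hoare P c T Q"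
  by (simp add: hoare_def)

lemma hoare_Seq:
  assumes "hoare P c T Q" "hoare Q d U R"
  shows "hoare P (Seq c d) (T + U) R"
proof (rule hoareI)
  fix s assume "P s"
  then have "runs c (\<lambda>t s'. t \<le> T \<and> Q s') s"
    using assms(1) by (simp add: hoare_def)
  then have "runs c (\<lambda>t. runs d (\<lambda>u s'. t + u \<le> T + U \<and> R s')) s"
  proof (rule runs_mono)
    fix t s' assume s': "t \<le> T \<and> Q s'"
    then have "runs d (\<lambda>u s'. u \<le> U \<and> R s') s'"
      using assms(2) by (simp add: hoare_def)
    then show "runs d (\<lambda>u s'. t + u \<le> T + U \<and> R s') s'"
      by (rule runs_mono) (use s' in simp)
  qed
  then show "runs (Seq c d) (\<lambda>t s'. t \<le> T + U \<and> R s') s"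
    by (simp add: runs_simps)
qed

lemma hoare_conseq:
  assumes "hoare P c T Q" "\<And>s. P' s \<Longrightarrow> P s" "T \<le> T'" "\<And>s. Q s \<Longrightarrow> Q' s"
  shows "hoare P' c T' Q'"
proof (rule hoareI)
  fix s assume "P' s"
  then have "runs c (\<lambda>t s'. t \<le> T \<and> Q s') s"
    using assms(1,2) by (simp add: hoare_def)
  then show "runs c (\<lambda>t s'. t \<le> T' \<and> Q' s') s"
    by (rule runs_mono) (use assms(3,4) in auto)
qed

text \<open>The iteration number k is a ghost index, and the guard being equivalent to k < N gives
  termination. The time bound may vary with k: in \<open>init_prog\<close> the inner loops have
  different lengths, whose sum is q.\<close>

lemma hoare_While:
  assumes body: "\<And>k. k < N \<Longrightarrow> hoare (I k) c (T k) (I (Suc k))"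
    and guard: "\<And>k s. I k s \<Longrightarrow> bval b s \<longleftrightarrow> k < N"
    and "k \<le> N"
  shows "hoare (I k) (While b c) ((\<Sum>l=k..<N. 1 + bcost b + T l) + 1 + bcost b) (I N)"
  using \<open>k \<le> N\<close>
proof (induction rule: inc_induct)
  case base
  show ?case
  proof (rule hoareI)
    fix s assume I: "I N s"
    then have "exec (While b c) s (1 + bcost b) s"
      using guard by (intro exec.While_False) auto
    with I show "runs (While b c) (\<lambda>t s'. t \<le> (\<Sum>l = N..<N. 1 + bcost b + T l) + 1 + bcost b \<and> I N s') s"
      by (auto simp: runs_def)
  qed
next
  case (step k)
  show ?case
  proof (rule hoareI)
    fix s assume I: "I k s"
    then obtain t s' where s': "exec c s t s'" "t \<le> T k" "I (Suc k) s'"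
      using body[OF step.hyps(2)] by (auto simp: hoare_def runs_def)
    then obtain u s'' where s'': "exec (While b c) s' u s''"
      "u \<le> (\<Sum>l=Suc k..<N. 1 + bcost b + T l) + 1 + bcost b" "I N s''"
      using step.IH by (auto simp: hoare_def runs_def)
    have "exec (While b c) s (1 + bcost b + t + u) s''"
      using s'(1) s''(1) guard[OF I] step.hyps(2) by (intro exec.While_True) auto
    with s'(2) s''(2,3)
    show "runs (While b c) (\<lambda>t s'. t \<le> (\<Sum>l = k..<N. 1 + bcost b + T l) + 1 + bcost b \<and> I N s') s"
      using step.hyps(2) by (force simp: runs_def sum.atLeast_Suc_lessThan)
  qed
qed

section \<open>Counting loops\<close>

abbreviation nv :: "string \<Rightarrow> nexp" where "nv x \<equiv> NCell x (NConst 0)"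
abbreviation rv :: "string \<Rightarrow> rexp" where "rv x \<equiv> RCell x (NConst 0)"

definition For :: "string \<Rightarrow> nexp \<Rightarrow> com \<Rightarrow> com" where
  "For x e c = Seq (NAssign x (NConst 0) (NConst 0))
     (While (NLess (nv x) e) (Seq c (NAssign x (NConst 0) (NAdd (nv x) (NConst 1)))))"

text \<open>The body establishes the invariant as it will hold after the increment, hence the
  updated counter in its postcondition. The bound e is evaluated before every iteration, so each
  invariant must fix its value. A round adds 4 + \<open>ncost e\<close> for the test and 6 for the
  increment; 7 + \<open>ncost e\<close> pays for the initialization and the failing test.\<close>

lemma hoare_For:
  assumes init: "\<And>s. P s \<Longrightarrow> I 0 (nset x 0 0 s)"
    and body: "\<And>k. k < N \<Longrightarrow> hoare (\<lambda>s. I k s \<and> nats s x 0 = k) c (T k)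
      (\<lambda>s. I (Suc k) (nset x 0 (Suc k) s) \<and> nats s x 0 = k)"
    and bound: "\<And>k s. I k s \<Longrightarrow> nval e s = N"
    and time: "(\<Sum>k<N. T k) + N * (10 + ncost e) + (7 + ncost e) \<le> U"
  shows "hoare P (For x e c) U (I N)"
proof -
  let ?J = "\<lambda>k s. I k s \<and> nats s x 0 = k"
  let ?inc = "NAssign x (NConst 0) (NAdd (nv x) (NConst 1))"
  have 1: "hoare P (NAssign x (NConst 0) (NConst 0)) 3 (?J 0)"
    by (rule hoareI) (simp add: runs_simps init)
  have 2: "hoare (?J k) (Seq c ?inc) (T k + 6) (?J (Suc k))" if "k < N" for k
    by (rule hoare_Seq[OF body[OF that]], rule hoareI) (auto simp: runs_simps)
  have 3: "hoare (?J 0) (While (NLess (nv x) e) (Seq c ?inc))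
    ((\<Sum>l=0..<N. 1 + bcost (NLess (nv x) e) + (T l + 6)) + 1 + bcost (NLess (nv x) e)) (?J N)"
    by (rule hoare_While[where I = ?J and T = "\<lambda>k. T k + 6", OF 2]) (auto dest: bound)
  have "3 + ((\<Sum>l=0..<N. 1 + bcost (NLess (nv x) e) + (T l + 6)) + 1 + bcost (NLess (nv x) e)) \<le> U"
    using time by (simp add: sum.distrib algebra_simps atLeast0LessThan)
  then show ?thesis
    unfolding For_def by (intro hoare_conseq[OF hoare_Seq[OF 1 3]]) auto
qed


section \<open>The algorithm\<close>

text \<open>Recording the state of each pair in \<open>st\<close> lets the later passes run through
  the pairs in one flat loop. The initial flags and values are A_{-1} and g_0.\<close>

definition init_prog :: com where
  "init_prog = For ''i'' (nv ''m'') (For ''j'' (NCell ''nacts'' (nv ''i''))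
     (Seq (NAssign ''st'' (nv ''q'') (nv ''i''))
     (Seq (NAssign ''A'' (nv ''q'') (NConst 1))
     (Seq (RAssign ''g'' (nv ''q'') (RCell ''r'' (nv ''q'')))
          (NAssign ''q'' (NConst 0) (NAdd (nv ''q'') (NConst 1)))))))"

definition range_prog :: com where
  "range_prog =
     Seq (RAssign ''lo'' (NConst 0) (rv ''r''))
    (Seq (RAssign ''hi'' (NConst 0) (rv ''r''))
    (For ''k'' (nv ''q'')
      (Seq (Cond (RLess (RCell ''r'' (nv ''k'')) (rv ''lo''))
             (RAssign ''lo'' (NConst 0) (RCell ''r'' (nv ''k''))) Skip)
           (Cond (RLess (rv ''hi'') (RCell ''r'' (nv ''k'')))
             (RAssign ''hi'' (NConst 0) (RCell ''r'' (nv ''k''))) Skip))))"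

text \<open>The smallest reward \<open>lo\<close> bounds all values of all \<open>g\<^sub>n\<close> from below, so it serves as \<open>-\<infinity>\<close> when
  maxima are computed.\<close>

definition max_prog :: com where
  "max_prog =
     Seq (For ''i'' (nv ''m'') (RAssign ''v'' (nv ''i'') (rv ''lo'')))
    (For ''k'' (nv ''q'')
      (Cond (BAnd (NLess (NConst 0) (NCell ''A'' (nv ''k'')))
               (RLess (RCell ''v'' (NCell ''st'' (nv ''k''))) (RCell ''g'' (nv ''k''))))
         (RAssign ''v'' (NCell ''st'' (nv ''k'')) (RCell ''g'' (nv ''k''))) Skip))"

definition remove_prog :: com where
  "remove_prog =
     For ''k'' (nv ''q'')
      (Cond (BAnd (NLess (NConst 0) (NCell ''A'' (nv ''k'')))
               (RLess (RCell ''g'' (nv ''k'')) (RCell ''v'' (NCell ''st'' (nv ''k'')))))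
         (Seq (NAssign ''A'' (nv ''k'') (NConst 0))
         (Seq (RAssign ''d'' (NConst 0)
                (RSub (RCell ''v'' (NCell ''st'' (nv ''k''))) (RCell ''g'' (nv ''k''))))
              (Cond (BAnd (RLess (RConst 0) (rv ''C'')) (BNot (RLess (rv ''d'') (rv ''C''))))
                 Skip (RAssign ''C'' (NConst 0) (rv ''d'')))))
         Skip)"

text \<open>Address expressions have no multiplication, so t walks through the cells of
  \<open>p\<close> in storage order in place of k * m + j. Dropped pairs are evaluated as well,
  which keeps t in step.\<close>

definition value_prog :: com where
  "value_prog =
     Seq (NAssign ''t'' (NConst 0) (NConst 0))
    (For ''k'' (nv ''q'')
      (Seq (RAssign ''g'' (nv ''k'') (RConst 0))
      (For ''j'' (nv ''m'')
        (Seq (RAssign ''g'' (nv ''k'') (RAdd (RCell ''g'' (nv ''k''))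
                (RMul (RCell ''p'' (nv ''t'')) (RCell ''v'' (nv ''j'')))))
             (NAssign ''t'' (NConst 0) (NAdd (nv ''t'') (NConst 1)))))))"

definition delta_prog :: com where
  "delta_prog = Cond (RLess (RConst 0) (rv ''C''))
     (RAssign ''Delta'' (NConst 0) (RDiv (rv ''C'') (RAdd (RSub (rv ''hi'') (rv ''lo'')) (rv ''C''))))
     (RAssign ''Delta'' (NConst 0) (RConst 1))"

definition prog :: com where
  "prog = Seq init_prog (Seq range_prog (Seq
     (For ''n'' (NAdd (nv ''m'') (NConst 1)) (Seq max_prog (Seq remove_prog value_prog)))
     delta_prog))"


section \<open>Correctness of the algorithm\<close>

lemma nth_concat_uniform:
  assumes "\<And>x. x \<in> set xs \<Longrightarrow> length (f x) = n" "k < length xs" "j < n"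
  shows "k * n + j < length (concat (map f xs))" "concat (map f xs) ! (k * n + j) = f (xs ! k) ! j"
  using assms
proof (induction xs arbitrary: k)
  case (Cons x xs)
  {
    case 1
    then show ?case using Cons.IH(1)[of "k - 1"] by (cases k) auto
  next
    case 2
    then show ?case using Cons.IH(2)[of "k - 1"] by (cases k) (auto simp: nth_append)
  }
qed auto

locale mdp_enum = fin_mdp M for M :: "'a mdp" +
  fixes as :: "nat \<Rightarrow> 'a list"
  assumes enum: "enumerates_acts M as"
begin

abbreviation q :: nat where "q \<equiv> length (pair_list M as)"
abbreviation st :: "nat \<Rightarrow> nat" where "st k \<equiv> fst (pair_list M as ! k)"
abbreviation ac :: "nat \<Rightarrow> 'a" where "ac k \<equiv> snd (pair_list M as ! k)"

definition off :: "nat \<Rightarrow> nat" where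
  "off i = (\<Sum>l<i. length (as l))"

lemma set_pair_list: "set (pair_list M as) = {(i, a). i < m \<and> a \<in> acts M i}"
  using enum by (auto simp: pair_list_def enumerates_acts_def)

lemma st_less: "k < q \<Longrightarrow> st k < m" and ac_mem: "k < q \<Longrightarrow> ac k \<in> acts M (st k)"
  using set_pair_list nth_mem[of k "pair_list M as"] by (auto simp: case_prod_beta)

lemma ex_pair: "\<lbrakk>i < m; a \<in> acts M i\<rbrakk> \<Longrightarrow> \<exists>k<q. st k = i \<and> ac k = a"
  using set_pair_list by (metis (mono_tags, lifting) case_prodI fst_conv in_set_conv_nth mem_Collect_eq snd_conv)

lemma off_m: "off m = q"
  by (simp add: off_def pair_list_def length_concat comp_def interv_sum_list_conv_sum_set_nat
      atLeast0LessThan)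

lemma q_eq: "q = num_pairs M"
  unfolding off_m[symmetric] off_def num_pairs_def
proof (rule sum.cong)
  fix i assume "i \<in> {..<m}"
  then show "length (as i) = card (acts M i)"
    using enum distinct_card[of "as i"] by (simp add: enumerates_acts_def)
qed simp

lemma nth_pair_list:
  assumes "i < m" "j < length (as i)"
  shows "off i + j < q" "pair_list M as ! (off i + j) = (i, as i ! j)"
proof -
  let ?f = "\<lambda>i. map (Pair i) (as i)"
  have "[0..<m] = [0..<i] @ i # [Suc i..<m]"
    using assms(1) upt_add_eq_append[of 0 i "m - i"] by (simp add: upt_conv_Cons)
  then have *: "pair_list M as = concat (map ?f [0..<i]) @ ?f i @ concat (map ?f [Suc i..<m])"
    by (simp add: pair_list_def)
  have "length (concat (map ?f [0..<i])) = off i"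
    by (simp add: off_def length_concat comp_def interv_sum_list_conv_sum_set_nat atLeast0LessThan)
  then show "off i + j < q" "pair_list M as ! (off i + j) = (i, as i ! j)"
    using assms(2) by (simp_all add: * nth_append)
qed

text \<open>With 0 < m this makes q positive: pair 0 exists for \<open>range_prog\<close>, and the
  lower-order terms of the running time are at most multiples of m q.\<close>

lemma m_le_q: "m \<le> q"
proof -
  have "{..<m} \<subseteq> st ` {..<q}"
    using ex_pair acts_nonempty by fastforce
  then show ?thesis
    using card_mono[of "st ` {..<q}" "{..<m}"] card_image_le[of "{..<q}" st] by simp
qed

section \<open>The input and the preparatory passes\<close>

definition rw :: "nat \<Rightarrow> real" where
  "rw k = rew M (st k) (ac k)"

lemma rw_image: "rw ` {..<q} = rews"
proof
  show "rews \<subseteq> rw ` {..<q}"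
    using ex_pair by (force simp: rews_def rw_def)
qed (auto simp: rw_def rew_mem st_less ac_mem)

definition data :: "ram_state \<Rightarrow> bool" where
  "data s \<longleftrightarrow> nats s ''m'' 0 = m \<and>
     (\<forall>k<q. \<forall>j<m. reals s ''p'' (k * m + j) = tprob M (st k) (ac k) j)"

definition input_data :: "ram_state \<Rightarrow> bool" where
  "input_data s \<longleftrightarrow> data s \<and> (\<forall>k<q. reals s ''r'' k = rw k) \<and> (\<forall>i<m. nats s ''nacts'' i = length (as i)) \<and>
     reals s ''C'' 0 = 0"

definition filled :: "nat \<Rightarrow> ram_state \<Rightarrow> bool" where
  "filled n s \<longleftrightarrow> nats s ''q'' 0 = n \<and>
     (\<forall>k<n. nats s ''st'' k = st k \<and> nats s ''A'' k = 1 \<and> reals s ''g'' k = rw k)"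

lemma input: "input_data (mdp_input M as)" "filled 0 (mdp_input M as)"
proof -
  have "reals (mdp_input M as) ''p'' (k * m + j) = tprob M (st k) (ac k) j" if "k < q" "j < m" for k j
    using nth_concat_uniform[of "pair_list M as" "\<lambda>(i, a). map (tprob M i a) [0..<m]" m k j] that
    by (auto simp: mdp_input_def nth_default_def case_prod_beta)
  then show "input_data (mdp_input M as)"
    by (auto simp: input_data_def data_def mdp_input_def nth_default_def rw_def case_prod_beta)
  show "filled 0 (mdp_input M as)"
    by (simp add: filled_def mdp_input_def)
qed

lemma init_prog: "hoare (\<lambda>s. input_data s \<and> filled 0 s) init_prog (60 * q + 30 * m + 9)
  (\<lambda>s. input_data s \<and> filled q s)"
proof -
  let ?body = "Seq (NAssign ''st'' (nv ''q'') (nv ''i''))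
     (Seq (NAssign ''A'' (nv ''q'') (NConst 1))
     (Seq (RAssign ''g'' (nv ''q'') (RCell ''r'' (nv ''q'')))
          (NAssign ''q'' (NConst 0) (NAdd (nv ''q'') (NConst 1)))))"
  let ?inner = "For ''j'' (NCell ''nacts'' (nv ''i'')) ?body"
  have inner: "hoare (\<lambda>s. (input_data s \<and> filled (off i) s) \<and> nats s ''i'' 0 = i) ?inner
      (60 * length (as i) + 10)
      (\<lambda>s. (input_data (nset ''i'' 0 (Suc i) s) \<and> filled (off (Suc i)) (nset ''i'' 0 (Suc i) s)) \<and>
        nats s ''i'' 0 = i)" if i: "i < m" for i
  proof (rule hoare_conseq)
    let ?I = "\<lambda>j s. (input_data s \<and> filled (off i + j) s) \<and> nats s ''i'' 0 = i"
    show "hoare (\<lambda>s. (input_data s \<and> filled (off i) s) \<and> nats s ''i'' 0 = i) ?inner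
      (60 * length (as i) + 10) (?I (length (as i)))"
    proof (rule hoare_For[where T = "\<lambda>_. 30" and I = ?I])
      fix j assume j: "j < length (as i)"
      show "hoare (\<lambda>s. ?I j s \<and> nats s ''j'' 0 = j) ?body 30
        (\<lambda>s. ?I (Suc j) (nset ''j'' 0 (Suc j) s) \<and> nats s ''j'' 0 = j)"
        by (rule hoareI)
          (use nth_pair_list[OF i j] in
            \<open>auto simp: runs_simps input_data_def data_def filled_def less_Suc_eq\<close>)
    qed (use i in \<open>auto simp: input_data_def data_def filled_def\<close>)
  qed (auto simp: input_data_def data_def filled_def off_def)
  have "hoare (\<lambda>s. input_data s \<and> filled 0 s) init_prog (60 * q + 30 * m + 9)
    (\<lambda>s. input_data s \<and> filled (off m) s)"
    unfolding init_prog_def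
  proof (rule hoare_For[where I = "\<lambda>i s. input_data s \<and> filled (off i) s", OF _ inner])
    show "(\<Sum>k<m. 60 * length (as k) + 10) + m * (10 + ncost (nv ''m'')) + (7 + ncost (nv ''m''))
      \<le> 60 * q + 30 * m + 9"
      by (simp add: sum.distrib off_m[symmetric] off_def sum_distrib_left)
  qed (auto simp: input_data_def data_def filled_def off_def)
  then show ?thesis
    by (simp add: off_m)
qed

lemma range_prog: "hoare (\<lambda>s. input_data s \<and> filled q s) range_prog (60 * q + 21)
  (\<lambda>s. input_data s \<and> filled q s \<and> reals s ''lo'' 0 = lo \<and> reals s ''hi'' 0 = hi)"
proof -
  \<comment> \<open>Inserting \<open>rw 0\<close>, the initial content of both cells, avoids the
    empty set at k = 0 and adds nothing at k = q.\<close>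
  define I where "I k s \<longleftrightarrow> (input_data s \<and> filled q s) \<and>
    reals s ''lo'' 0 = Min (insert (rw 0) (rw ` {..<k})) \<and>
    reals s ''hi'' 0 = Max (insert (rw 0) (rw ` {..<k}))" for k s
  have "0 < q"
    using m_le_q nstates_pos by linarith
  then have "insert (rw 0) (rw ` {..<q}) = rews"
    using rw_image by auto
  then have I_q: "I q s \<Longrightarrow> input_data s \<and> filled q s \<and> reals s ''lo'' 0 = lo \<and> reals s ''hi'' 0 = hi" for s
    by (simp add: I_def)
  have I_Suc: "Min (insert (rw 0) (rw ` {..<Suc k})) = min (rw k) (Min (insert (rw 0) (rw ` {..<k})))"
    "Max (insert (rw 0) (rw ` {..<Suc k})) = max (rw k) (Max (insert (rw 0) (rw ` {..<k})))" for k
    by (simp_all add: lessThan_Suc insert_commute[of "rw 0"])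
  let ?body = "Seq (Cond (RLess (RCell ''r'' (nv ''k'')) (rv ''lo''))
             (RAssign ''lo'' (NConst 0) (RCell ''r'' (nv ''k''))) Skip)
           (Cond (RLess (rv ''hi'') (RCell ''r'' (nv ''k'')))
             (RAssign ''hi'' (NConst 0) (RCell ''r'' (nv ''k''))) Skip)"
  have body: "hoare (\<lambda>s. I k s \<and> nats s ''k'' 0 = k) ?body 40
      (\<lambda>s. I (Suc k) (nset ''k'' 0 (Suc k) s) \<and> nats s ''k'' 0 = k)" if "k < q" for k
  proof (rule hoareI)
    fix s assume "I k s \<and> nats s ''k'' 0 = k"
    moreover define a b where "a = Min (insert (rw 0) (rw ` {..<k}))" and "b = Max (insert (rw 0) (rw ` {..<k}))"
    ultimately have s: "input_data s" "filled q s" "reals s ''lo'' 0 = a" "reals s ''hi'' 0 = b"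
      "nats s ''k'' 0 = k" and r: "reals s ''r'' k = rw k"
      using that by (simp_all add: I_def input_data_def)
    show "runs ?body (\<lambda>t s'. t \<le> 40 \<and> I (Suc k) (nset ''k'' 0 (Suc k) s') \<and> nats s' ''k'' 0 = k) s"
      unfolding I_def I_Suc a_def[symmetric] b_def[symmetric] using s r
      by (cases "rw k < a"; cases "b < rw k")
        (simp_all add: runs_simps input_data_def data_def filled_def)
  qed
  have "hoare (\<lambda>s. input_data s \<and> filled q s) range_prog (6 + (6 + (60 * q + 9))) (I q)"
    unfolding range_prog_def
  proof (intro hoare_Seq)
    show "hoare (\<lambda>s. input_data s \<and> filled q s) (RAssign ''lo'' (NConst 0) (rv ''r'')) 6
        (\<lambda>s. input_data s \<and> filled q s \<and> reals s ''lo'' 0 = rw 0)"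
      by (rule hoareI) (use \<open>0 < q\<close> in \<open>simp add: runs_simps input_data_def data_def filled_def\<close>)
    show "hoare (\<lambda>s. input_data s \<and> filled q s \<and> reals s ''lo'' 0 = rw 0)
        (RAssign ''hi'' (NConst 0) (rv ''r'')) 6 (I 0)"
      by (rule hoareI) (use \<open>0 < q\<close> in \<open>simp add: runs_simps input_data_def data_def filled_def I_def\<close>)
    show "hoare (I 0) (For ''k'' (nv ''q'') ?body) (60 * q + 9) (I q)"
    proof (rule hoare_For[OF _ body])
      show "(\<Sum>k<q. 40) + q * (10 + ncost (nv ''q'')) + (7 + ncost (nv ''q'')) \<le> 60 * q + 9"
        by simp
    qed (simp_all add: I_def input_data_def data_def filled_def)
  qed
  then show ?thesis
    by (rule hoare_conseq) (use I_q in auto)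
qed


subsection \<open>One round of the main loop\<close>

definition core :: "ram_state \<Rightarrow> bool" where
  "core s \<longleftrightarrow> data s \<and> nats s ''q'' 0 = q \<and> (\<forall>k<q. nats s ''st'' k = st k) \<and>
     reals s ''lo'' 0 = lo \<and> reals s ''hi'' 0 = hi"

text \<open>The cell \<open>C\<close> holds 0 as long as no gap has been found, i.e. while \<open>C\<^sub>n = \<infinity>\<close>.\<close>

definition min_gap :: "real set \<Rightarrow> real" where
  "min_gap S = (if S = {} then 0 else Min S)"

text \<open>The condition mirrors the guard in \<open>remove_prog\<close>. Positivity of the losses
  makes 0 unambiguous as a mark for the empty set.\<close>

lemma min_gap_insert:
  assumes "finite S" "\<And>x. x \<in> S \<Longrightarrow> 0 < x"
  shows "min_gap (insert d S) = (if 0 < min_gap S \<and> \<not> d < min_gap S then min_gap S else d)"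
proof (cases "S = {}")
  case False
  then have "0 < Min S"
    using assms by simp
  moreover have "min_gap (insert d S) = min d (Min S)" "min_gap S = Min S"
    using False assms(1) by (simp_all add: min_gap_def)
  moreover have "min d c = (if 0 < c \<and> \<not> d < c then c else d)" if "0 < c" for c
    using that by auto
  ultimately show ?thesis
    by (simp only:)
qed (simp add: min_gap_def)

text \<open>The losses found when round n has treated k pairs. Position q of round n coincides with
  position 0 of round n + 1, which glues the rounds together.\<close>

definition gaps_before :: "nat \<Rightarrow> nat \<Rightarrow> real set" where
  "gaps_before n k = (\<Union>l<n. gaps_at l) \<union>
     {r_val M n (st l) - g_val M n (st l) (ac l) | l. l < k \<and> ac l \<in> A_prev M n (st l) - A_set M n (st l)}"

definition alive :: "nat \<Rightarrow> nat \<Rightarrow> ram_state \<Rightarrow> bool" where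
  "alive n k s \<longleftrightarrow>
     (\<forall>l<q. nats s ''A'' l = of_bool (ac l \<in> (if l < k then A_set M n (st l) else A_prev M n (st l)))) \<and>
     reals s ''C'' 0 = min_gap (gaps_before n k)"

lemma gaps_before_0: "gaps_before (Suc n) 0 = gaps_before n q"
proof -
  have "gaps_at n = {r_val M n (st l) - g_val M n (st l) (ac l) | l.
      l < q \<and> ac l \<in> A_prev M n (st l) - A_set M n (st l)}" (is "_ = ?G")
  proof
    show "gaps_at n \<subseteq> ?G"
    proof
      fix x assume "x \<in> gaps_at n"
      then obtain i a where ia: "i < m" "a \<in> A_prev M n i - A_set M n i" "x = r_val M n i - g_val M n i a"
        by (auto simp: gaps_at_def)
      then obtain l where "l < q" "st l = i" "ac l = a"
        using ex_pair[of i a] A_prev_subset by blast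
      with ia show "x \<in> ?G"
        by blast
    qed
    show "?G \<subseteq> gaps_at n"
      using st_less by (fastforce simp: gaps_at_def)
  qed
  then show ?thesis
    by (simp add: gaps_before_def lessThan_Suc Un_commute)
qed

lemma gaps_before_q: "gaps_before n q = gaps n"
  unfolding gaps_before_0[symmetric] by (simp add: gaps_before_def gaps_def lessThan_Suc_atMost)

lemma gaps_before_Suc:
  "gaps_before n (Suc k) = (if ac k \<in> A_prev M n (st k) - A_set M n (st k)
     then insert (r_val M n (st k) - g_val M n (st k) (ac k)) (gaps_before n k) else gaps_before n k)"
  by (auto simp: gaps_before_def less_Suc_eq)

lemma gaps_before_mono: "k \<le> k' \<Longrightarrow> gaps_before n k \<subseteq> gaps_before n k'"
  by (fastforce simp: gaps_before_def)

lemma gaps_before_props: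
  assumes "k \<le> q"
  shows "finite (gaps_before n k)" "x \<in> gaps_before n k \<Longrightarrow> 0 < x"
  using gaps_before_mono[OF assms, of n] finite_subset[OF _ finite_gaps[of n]] gaps_pos[of x n]
  unfolding gaps_before_q by auto

lemma alive_0: "alive (Suc n) 0 s \<longleftrightarrow> alive n q s"
  by (auto simp: alive_def gaps_before_0)

definition has_values :: "nat \<Rightarrow> ram_state \<Rightarrow> bool" where
  "has_values n s \<longleftrightarrow> (\<forall>k<q. reals s ''g'' k = g_val M n (st k) (ac k))"

definition has_max :: "nat \<Rightarrow> ram_state \<Rightarrow> bool" where
  "has_max n s \<longleftrightarrow> (\<forall>i<m. reals s ''v'' i = r_val M n i)"

definition partial_max :: "nat \<Rightarrow> nat \<Rightarrow> nat \<Rightarrow> real" where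
  "partial_max n k i = Max (insert lo ((\<lambda>l. g_val M n i (ac l)) ` {l. l < k \<and> st l = i \<and> ac l \<in> A_prev M n i}))"

lemma partial_max_0: "partial_max n 0 i = lo"
  by (simp add: partial_max_def)

lemma partial_max_Suc:
  "partial_max n (Suc k) i = (if st k = i \<and> ac k \<in> A_prev M n i
     then max (g_val M n i (ac k)) (partial_max n k i) else partial_max n k i)"
proof -
  have "{l. l < Suc k \<and> st l = i \<and> ac l \<in> A_prev M n i} =
    (if st k = i \<and> ac k \<in> A_prev M n i then insert k else id) {l. l < k \<and> st l = i \<and> ac l \<in> A_prev M n i}"
    by (auto simp: less_Suc_eq)
  then show ?thesis
    by (auto simp: partial_max_def insert_commute[of lo])
qed

text \<open>Every surviving action has a number below q, and the added lower bound \<open>lo\<close>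
  is absorbed because r_n never falls below it.\<close>

lemma partial_max_q:
  assumes "i < m"
  shows "partial_max n q i = r_val M n i"
proof -
  have *: "ac ` {l. l < q \<and> st l = i \<and> ac l \<in> A_prev M n i} = A_prev M n i"
    using ex_pair[OF assms] A_prev_subset[of n i] by force
  have "(\<lambda>l. g_val M n i (ac l)) ` {l. l < q \<and> st l = i \<and> ac l \<in> A_prev M n i} = g_val M n i ` A_prev M n i"
    using arg_cong[OF *, of "image (g_val M n i)"] by (simp add: image_image)
  then have "partial_max n q i = max lo (r_val M n i)"
    using A_prev_finite[OF assms] A_prev_nonempty[OF assms] by (simp add: partial_max_def r_val.simps)
  then show ?thesis
    using r_bounds[OF assms] by simp
qed

lemma max_prog: "hoare (\<lambda>s. core s \<and> alive n 0 s \<and> has_values n s \<and> nats s ''n'' 0 = n) max_prog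
  (30 * m + 60 * q + 18) (\<lambda>s. core s \<and> alive n 0 s \<and> has_values n s \<and> has_max n s \<and> nats s ''n'' 0 = n)"
proof -
  let ?P = "\<lambda>s. core s \<and> alive n 0 s \<and> has_values n s \<and> nats s ''n'' 0 = n"
  define I where "I k s \<longleftrightarrow> ?P s \<and> (\<forall>i<m. reals s ''v'' i = partial_max n k i)" for k s
  have "hoare ?P max_prog ((30 * m + 9) + (60 * q + 9)) (I q)"
    unfolding max_prog_def
  proof (rule hoare_Seq)
    have "hoare ?P (For ''i'' (nv ''m'') (RAssign ''v'' (nv ''i'') (rv ''lo''))) (30 * m + 9)
      (\<lambda>s. ?P s \<and> (\<forall>i<m. reals s ''v'' i = lo))"
    proof (rule hoare_For[where T = "\<lambda>_. 10" and I = "\<lambda>i s. ?P s \<and> (\<forall>j<i. reals s ''v'' j = lo)"])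
      show "hoare (\<lambda>s. (?P s \<and> (\<forall>j<i. reals s ''v'' j = lo)) \<and> nats s ''i'' 0 = i)
        (RAssign ''v'' (nv ''i'') (rv ''lo'')) 10
        (\<lambda>s. (?P (nset ''i'' 0 (Suc i) s) \<and> (\<forall>j<Suc i. reals (nset ''i'' 0 (Suc i) s) ''v'' j = lo)) \<and>
          nats s ''i'' 0 = i)" for i
        by (rule hoareI) (auto simp: runs_simps core_def data_def alive_def has_values_def)
    qed (auto simp: core_def data_def alive_def has_values_def)
    then show "hoare ?P (For ''i'' (nv ''m'') (RAssign ''v'' (nv ''i'') (rv ''lo''))) (30 * m + 9) (I 0)"
      by (rule hoare_conseq) (auto simp: I_def partial_max_0)
    show "hoare (I 0) (For ''k'' (nv ''q'')
      (Cond (BAnd (NLess (NConst 0) (NCell ''A'' (nv ''k'')))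
               (RLess (RCell ''v'' (NCell ''st'' (nv ''k''))) (RCell ''g'' (nv ''k''))))
         (RAssign ''v'' (NCell ''st'' (nv ''k'')) (RCell ''g'' (nv ''k''))) Skip)) (60 * q + 9) (I q)"
    proof (rule hoare_For[where T = "\<lambda>_. 40"])
      show "hoare (\<lambda>s. I k s \<and> nats s ''k'' 0 = k)
        (Cond (BAnd (NLess (NConst 0) (NCell ''A'' (nv ''k'')))
               (RLess (RCell ''v'' (NCell ''st'' (nv ''k''))) (RCell ''g'' (nv ''k''))))
         (RAssign ''v'' (NCell ''st'' (nv ''k'')) (RCell ''g'' (nv ''k''))) Skip) 40
        (\<lambda>s. I (Suc k) (nset ''k'' 0 (Suc k) s) \<and> nats s ''k'' 0 = k)" if "k < q" for k
        by (rule hoareI)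
          (use that st_less[OF that] in
            \<open>auto simp: I_def runs_simps core_def data_def alive_def has_values_def partial_max_Suc max_def\<close>)
    qed (auto simp: I_def core_def data_def alive_def has_values_def)
  qed
  then show ?thesis
    by (rule hoare_conseq) (auto simp: I_def has_max_def partial_max_q)
qed

lemma remove_prog:
  "hoare (\<lambda>s. core s \<and> alive n 0 s \<and> has_values n s \<and> has_max n s \<and> nats s ''n'' 0 = n) remove_prog
    (100 * q + 9) (\<lambda>s. core s \<and> alive n q s \<and> has_max n s \<and> nats s ''n'' 0 = n)"
proof -
  let ?P = "\<lambda>s. core s \<and> has_values n s \<and> has_max n s \<and> nats s ''n'' 0 = n"
  have "hoare (\<lambda>s. core s \<and> alive n 0 s \<and> has_values n s \<and> has_max n s \<and> nats s ''n'' 0 = n) remove_prog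
    (100 * q + 9) (\<lambda>s. ?P s \<and> alive n q s)"
    unfolding remove_prog_def
  proof (rule hoare_For[where T = "\<lambda>_. 80" and I = "\<lambda>k s. ?P s \<and> alive n k s"])
    fix k assume k: "k < q"
    \<comment> \<open>On flagged pairs the exact comparison of g with the maximum decides membership
      in the argmax.\<close>
    have less: "g_val M n (st k) (ac k) < r_val M n (st k) \<longleftrightarrow> ac k \<notin> A_set M n (st k)"
      if "ac k \<in> A_prev M n (st k)"
      using g_less_r[OF st_less[OF k], of "ac k" n] that A_set_eq[OF st_less[OF k], of n] by auto
    have A: "ac k \<in> A_set M n (st k) \<Longrightarrow> ac k \<in> A_prev M n (st k)"
      using A_set_subset_prev by blast
    note min_gap = min_gap_insert[OF gaps_before_props[OF less_imp_le[OF k]]]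
    show "hoare (\<lambda>s. (?P s \<and> alive n k s) \<and> nats s ''k'' 0 = k)
      (Cond (BAnd (NLess (NConst 0) (NCell ''A'' (nv ''k'')))
               (RLess (RCell ''g'' (nv ''k'')) (RCell ''v'' (NCell ''st'' (nv ''k'')))))
         (Seq (NAssign ''A'' (nv ''k'') (NConst 0))
         (Seq (RAssign ''d'' (NConst 0)
                (RSub (RCell ''v'' (NCell ''st'' (nv ''k''))) (RCell ''g'' (nv ''k''))))
              (Cond (BAnd (RLess (RConst 0) (rv ''C'')) (BNot (RLess (rv ''d'') (rv ''C''))))
                 Skip (RAssign ''C'' (NConst 0) (rv ''d'')))))
         Skip) 80
      (\<lambda>s. (?P (nset ''k'' 0 (Suc k) s) \<and> alive n (Suc k) (nset ''k'' 0 (Suc k) s)) \<and> nats s ''k'' 0 = k)"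
    proof (rule hoareI, goal_cases)
      case (1 s)
      consider "ac k \<notin> A_prev M n (st k)" | "ac k \<in> A_set M n (st k)"
        | "ac k \<in> A_prev M n (st k) - A_set M n (st k)"
        by blast
      then show ?case
      proof cases
        case 1
        then show ?thesis
          using \<open>(?P s \<and> alive n k s) \<and> nats s ''k'' 0 = k\<close> k A
          by (auto simp: runs_simps core_def data_def alive_def has_values_def has_max_def
              gaps_before_Suc less_Suc_eq)
      next
        case 2
        then show ?thesis
          using \<open>(?P s \<and> alive n k s) \<and> nats s ''k'' 0 = k\<close> k A st_less[OF k] less
          by (auto simp: runs_simps core_def data_def alive_def has_values_def has_max_def
              gaps_before_Suc less_Suc_eq)
      next
        case 3
        then show ?thesis
          using \<open>(?P s \<and> alive n k s) \<and> nats s ''k'' 0 = k\<close> k A st_less[OF k] less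
          by (auto simp: runs_simps core_def data_def alive_def has_values_def has_max_def
              gaps_before_Suc less_Suc_eq min_gap)
      qed
    qed
  qed (auto simp: core_def data_def alive_def has_values_def has_max_def)
  then show ?thesis
    by (rule hoare_conseq) auto
qed

lemma value_prog:
  "hoare (\<lambda>s. core s \<and> alive n q s \<and> has_max n s \<and> nats s ''n'' 0 = n) value_prog
    (q * (60 * m + 40) + 12) (\<lambda>s. core s \<and> alive n q s \<and> has_values (Suc n) s \<and> nats s ''n'' 0 = n)"
proof -
  let ?P = "\<lambda>s. core s \<and> alive n q s \<and> has_max n s \<and> nats s ''n'' 0 = n"
  let ?g = "\<lambda>k s. (\<forall>l<k. reals s ''g'' l = g_val M (Suc n) (st l) (ac l))"
  let ?I = "\<lambda>k s. ?P s \<and> nats s ''t'' 0 = k * m \<and> ?g k s"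
  let ?loop = "For ''j'' (nv ''m'')
        (Seq (RAssign ''g'' (nv ''k'') (RAdd (RCell ''g'' (nv ''k''))
                (RMul (RCell ''p'' (nv ''t'')) (RCell ''v'' (nv ''j'')))))
             (NAssign ''t'' (NConst 0) (NAdd (nv ''t'') (NConst 1))))"
  have inner: "hoare (\<lambda>s. ?I k s \<and> nats s ''k'' 0 = k) (Seq (RAssign ''g'' (nv ''k'') (RConst 0)) ?loop)
    (60 * m + 20) (\<lambda>s. ?I (Suc k) (nset ''k'' 0 (Suc k) s) \<and> nats s ''k'' 0 = k)" if k: "k < q" for k
  proof -
    define J where "J j s \<longleftrightarrow> (?P s \<and> nats s ''t'' 0 = k * m + j \<and> ?g k s \<and> nats s ''k'' 0 = k) \<and>
      reals s ''g'' k = (\<Sum>y<j. tprob M (st k) (ac k) y * r_val M n y)" for j s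
    have "hoare (\<lambda>s. ?I k s \<and> nats s ''k'' 0 = k) (Seq (RAssign ''g'' (nv ''k'') (RConst 0)) ?loop)
      (5 + (60 * m + 10)) (J m)"
    proof (rule hoare_Seq)
      show "hoare (\<lambda>s. ?I k s \<and> nats s ''k'' 0 = k) (RAssign ''g'' (nv ''k'') (RConst 0)) 5 (J 0)"
        by (rule hoareI) (auto simp: J_def runs_simps core_def data_def alive_def has_max_def)
      show "hoare (J 0) ?loop (60 * m + 10) (J m)"
      proof (rule hoare_For[where T = "\<lambda>_. 40"])
        show "hoare (\<lambda>s. J j s \<and> nats s ''j'' 0 = j)
          (Seq (RAssign ''g'' (nv ''k'') (RAdd (RCell ''g'' (nv ''k''))
                (RMul (RCell ''p'' (nv ''t'')) (RCell ''v'' (nv ''j'')))))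
             (NAssign ''t'' (NConst 0) (NAdd (nv ''t'') (NConst 1)))) 40
          (\<lambda>s. J (Suc j) (nset ''j'' 0 (Suc j) s) \<and> nats s ''j'' 0 = j)" if "j < m" for j
          by (rule hoareI)
            (use that k in \<open>auto simp: J_def runs_simps core_def data_def alive_def has_max_def\<close>)
      qed (auto simp: J_def core_def data_def alive_def has_max_def)
    qed
    then show ?thesis
      by (rule hoare_conseq)
        (auto simp: J_def core_def data_def alive_def has_max_def less_Suc_eq g_val.simps(2))
  qed
  have "hoare ?P value_prog (3 + (q * (60 * m + 40) + 9)) (?I q)"
    unfolding value_prog_def
  proof (rule hoare_Seq)
    show "hoare ?P (NAssign ''t'' (NConst 0) (NConst 0)) 3 (?I 0)"
      by (rule hoareI) (auto simp: runs_simps core_def data_def alive_def has_max_def)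
    show "hoare (?I 0) (For ''k'' (nv ''q'') (Seq (RAssign ''g'' (nv ''k'') (RConst 0)) ?loop))
      (q * (60 * m + 40) + 9) (?I q)"
      by (rule hoare_For[OF _ inner]) (auto simp: core_def data_def alive_def has_max_def algebra_simps)
  qed
  then show ?thesis
    by (rule hoare_conseq) (auto simp: has_values_def)
qed


subsection \<open>The whole program\<close>

lemma prog: "hoare (\<lambda>s. s = mdp_input M as) prog (1000 * (m\<^sup>2 * q))
  (outputs M as (Delta_val M (L_idx M)) (A_set M (L_idx M)))"
proof -
  let ?I = "\<lambda>n s. core s \<and> alive n 0 s \<and> has_values n s"
  let ?T = "(30 * m + 60 * q + 18) + ((100 * q + 9) + (q * (60 * m + 40) + 12))"
  have round: "hoare (\<lambda>s. ?I n s \<and> nats s ''n'' 0 = n) (Seq max_prog (Seq remove_prog value_prog)) ?T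
    (\<lambda>s. ?I (Suc n) (nset ''n'' 0 (Suc n) s) \<and> nats s ''n'' 0 = n)" for n
  proof (rule hoare_conseq)
    show "hoare (\<lambda>s. core s \<and> alive n 0 s \<and> has_values n s \<and> nats s ''n'' 0 = n)
      (Seq max_prog (Seq remove_prog value_prog)) ?T
      (\<lambda>s. core s \<and> alive n q s \<and> has_values (Suc n) s \<and> nats s ''n'' 0 = n)"
      by (rule hoare_Seq[OF max_prog hoare_Seq[OF remove_prog value_prog]])
  qed (auto simp: alive_0, auto simp: core_def data_def alive_def has_values_def)
  have main: "hoare (?I 0) (For ''n'' (NAdd (nv ''m'') (NConst 1)) (Seq max_prog (Seq remove_prog value_prog)))
    ((m + 1) * (?T + 14) + 11) (?I (m + 1))"
  proof (rule hoare_For[where T = "\<lambda>_. ?T"])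
    show "?I 0 (nset ''n'' 0 0 s)" if "?I 0 s" for s
      using that by (auto simp: core_def data_def alive_def has_values_def)
    show "(\<Sum>k<m + 1. ?T) + (m + 1) * (10 + ncost (NAdd (nv ''m'') (NConst 1))) +
      (7 + ncost (NAdd (nv ''m'') (NConst 1))) \<le> (m + 1) * (?T + 14) + 11"
      by (simp add: algebra_simps)
    show "hoare (\<lambda>s. ?I k s \<and> nats s ''n'' 0 = k) (Seq max_prog (Seq remove_prog value_prog)) ?T
      (\<lambda>s. ?I (Suc k) (nset ''n'' 0 (Suc k) s) \<and> nats s ''n'' 0 = k)" for k
      by (rule round)
  qed (simp add: core_def data_def)
  have start: "hoare (\<lambda>s. input_data s \<and> filled q s) range_prog (60 * q + 21) (?I 0)"
    by (rule hoare_conseq[OF range_prog])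
      (use ac_mem in \<open>auto simp: input_data_def filled_def core_def alive_def has_values_def rw_def
        gaps_before_def min_gap_def\<close>)
  have delta: "hoare (?I (m + 1)) delta_prog 30
    (outputs M as (Delta_val M (L_idx M)) (A_set M (L_idx M)))"
  proof (rule hoareI)
    fix s assume "?I (m + 1) s"
    then have s: "core s" "alive m q s"
      \<comment> \<open>The loop ends before a round m + 1, a position that equals the end of round
        m: the flags describe A_m and the cell \<open>C\<close> the losses of rounds 0 to m.\<close>
      using alive_0[of m s] by simp_all
    have L: "L_idx M \<le> m"
      by (rule L_idx_le)
    have C: "reals s ''C'' 0 = min_gap (gaps (L_idx M))"
      using s(2) gaps_L_idx[OF L] by (simp add: alive_def gaps_before_q)
    have "0 < min_gap (gaps (L_idx M)) \<longleftrightarrow> gaps (L_idx M) \<noteq> {}"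
      using finite_gaps gaps_pos by (auto simp: min_gap_def)
    moreover have "nats s ''A'' k = of_bool (ac k \<in> A_set M (L_idx M) (st k))" if "k < q" for k
      using s(2) that A_set_L_idx[OF L st_less[OF that]] by (simp add: alive_def)
    ultimately show "runs delta_prog (\<lambda>t s'. t \<le> 30 \<and> outputs M as (Delta_val M (L_idx M)) (A_set M (L_idx M)) s') s"
      using s(1) C
      by (auto simp: delta_prog_def runs_simps outputs_def core_def Delta_val_eq min_gap_def case_prod_beta)
  qed
  have "hoare (\<lambda>s. input_data s \<and> filled 0 s) prog
    ((60 * q + 30 * m + 9) + ((60 * q + 21) + (((m + 1) * (?T + 14) + 11) + 30)))
    (outputs M as (Delta_val M (L_idx M)) (A_set M (L_idx M)))"
    unfolding prog_def
    by (rule hoare_Seq[OF init_prog hoare_Seq[OF start hoare_Seq[OF main delta]]])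
  then show ?thesis
  proof (rule hoare_conseq)
    let ?x = "m\<^sup>2 * q"
    \<comment> \<open>Absorbing all terms into m q gives 30 + 200 + 60 + 53 = 343 per round and 120
      + 30 + 71 = 221 outside. With m + 1 <= 2 m the total is at most 686 + 221 times m^2 q.\<close>
    have "m \<le> m * q" "q \<le> m * q" "1 \<le> m * q"
      using m_le_q nstates_pos by auto
    moreover have "?T + 14 = 30 * m + 200 * q + 60 * (m * q) + 53"
      by (simp add: algebra_simps)
    ultimately have "?T + 14 \<le> 343 * (m * q)" and rest: "120 * q + 30 * m + 71 \<le> 221 * (m * q)"
      by linarith+
    moreover have "m + 1 \<le> 2 * m"
      using nstates_pos by simp
    ultimately have "(m + 1) * (?T + 14) \<le> (2 * m) * (343 * (m * q))"
      by (intro mult_mono) simp_all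
    also have "\<dots> = 686 * ?x"
      by (simp add: power2_eq_square)
    finally have "(m + 1) * (?T + 14) \<le> 686 * ?x" .
    moreover have "m * q \<le> ?x"
      by (simp add: power2_eq_square)
    ultimately show "(60 * q + 30 * m + 9) + ((60 * q + 21) + (((m + 1) * (?T + 14) + 11) + 30)) \<le> 1000 * ?x"
      using rest by linarith
  qed (use input in auto)
qed

end

theorem mainTheorem8:
  shows "(\<exists>(prog :: com) (c :: nat). \<forall>(M :: 'a mdp) (as :: nat \<Rightarrow> 'a list).
            finite_mdp M \<longrightarrow> enumerates_acts M as \<longrightarrow>
            (\<exists>t s. exec prog (mdp_input M as) t s \<and>
                   t \<le> c * (nstates M ^ 2 * num_pairs M) \<and>
                   outputs M as (Delta_val M (L_idx M)) (A_set M (L_idx M)) s))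
       \<and> (\<forall>M :: 'a mdp. finite_mdp M \<longrightarrow>
            Delta_val M (L_idx M) \<in> {0<..1} \<and>
            (\<forall>\<phi>\<in>F_set M (L_idx M). \<forall>\<alpha>\<in>{0..Delta_val M (L_idx M)}.
               \<alpha> < 1 \<longrightarrow> optimal_policy M \<alpha> \<phi>))"
proof (intro conjI allI impI ballI, rule exI[of _ prog], rule exI[of _ 1000], intro allI impI)
  fix M :: "'a mdp" and as :: "nat \<Rightarrow> 'a list"
  assume "finite_mdp M" "enumerates_acts M as"
  then interpret mdp_enum M as
    by unfold_locales
  show "\<exists>t s. exec prog (mdp_input M as) t s \<and> t \<le> 1000 * (nstates M ^ 2 * num_pairs M) \<and>
    outputs M as (Delta_val M (L_idx M)) (A_set M (L_idx M)) s"
    using prog by (auto simp: hoare_def runs_def q_eq)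
next
  fix M :: "'a mdp"
  assume "finite_mdp M"
  then interpret fin_mdp M
    by unfold_locales
  show "Delta_val M (L_idx M) \<in> {0<..1}"
    by (rule Delta_val_bounds)
  show "optimal_policy M \<alpha> \<phi>"
    if "\<phi> \<in> F_set M (L_idx M)" "\<alpha> \<in> {0..Delta_val M (L_idx M)}" "\<alpha> < 1" for \<phi> \<alpha>
    using that by (intro optimal_policy_L_idx) auto
qed

end
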